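(* Let $\Omega\subset\mathbb{R}^2$ be a bounded polygonal domain with a triangulation $\mathcal{T}_h$ (a finite partition into rectangular or triangular elements), let $q\ge 0$ be an integer, and let $\mathcal{V}_h$ be the space of piecewise polynomials of degree at most $q$ on $\mathcal{T}_h$. Let $\bm{u}_h(t,x,y)=(u_{1,h},u_{2,h},u_{3,h},u_{4,h})^\top$, $t\ge 0$, be a solution, differentiable in $t$ and with each component in $\mathcal{V}_h$ for every $t$, of the semi-discrete discontinuous Galerkin scheme with Lax–Friedrichs flux for the two-dimensional nonlinear Dirac equation: for every $\mathcal{K}\in\mathcal{T}_h$, every $\ell\in\{1,2,3,4\}$ and every $v\in\mathcal{V}_h$, $$\int_{\mathcal{K}}(\partial_t u_{\ell,h})\,v\,\mathrm{d}x\,\mathrm{d}y=-\sum_{e\in\partial\mathcal{K}}\int_e \widehat{h}_{\ell,e\mathcal{K}}\,v^-\,\mathrm{d}S+\int_{\mathcal{K}}\bigl(\bm{f}_\ell(\bm{u}_h)\cdot\nabla v+\mathcal{M}_\ell(\bm{u}_h)\,v\bigr)\,\mathrm{d}x\,\mathrm{d}y,$$ where the vector $\widehat{\bm{h}}_{e\mathcal{K}}=(\widehat{h}_{1,e\mathcal{K}},\dots,\widehat{h}_{4,e\mathcal{K}})^\top$ is $$\widehat{\bm{h}}_{e\mathcal{K}}=\tfrac12\Bigl[\bm{f}(\bm{u}_h^-)\bm{n}_{e\mathcal{K}}^\top+\bm{f}(\bm{u}_h^+)\bm{n}_{e\mathcal{K}}^\top-(\bm{u}_h^+-\bm{u}_h^-)\Bigr].$$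 Impose the homogeneous Dirichlet boundary condition, i.e. the boundary value of $\bm{u}_h$ used as exterior value $\bm{u}_h^+$ on edges contained in $\partial\Omega$ is $0$. Let $$Q_h(t)=\int_\Omega\sum_{\ell=1}^4|u_{\ell,h}(t,x,y)|^2\,\mathrm{d}x\,\mathrm{d}y .$$ If $Q_h(0)<+\infty$, then $\frac{\mathrm{d}}{\mathrm{d}t}Q_h(t)\le 0$ for all $t\ge0$; consequently $Q_h(t)\le Q_h(0)$ for any $t\ge 0$.
   Context: Real form of the 2D nonlinear Dirac equation: writing the spinor $\Psi=(\psi_1,\psi_2)^\top\in\mathbb{C}^2$ as $\bm{u}=(u_1,u_2,u_3,u_4)^\top=(\mathrm{Re}\,\psi_1,\mathrm{Re}\,\psi_2,\mathrm{Im}\,\psi_1,\mathrm{Im}\,\psi_2)^\top$, the equation is $\partial_t\bm{u}=-\nabla\cdot\bm{f}(\bm{u})+\bm{\mathcal{M}}(\bm{u})$, where $\bm{f}(\bm{u})=(\alpha\bm{u},\beta\bm{u})$ is a $4\times2$ matrix with $\ell$-th row $\bm{f}_\ell(\bm{u})$, $\nabla\cdot\bm{f}(\bm{u})=\alpha\partial_x\bm{u}+\beta\partial_y\bm{u}$, and $\bm{\mathcal{M}}(\bm{u})=(\mathcal{M}_1,\dots,\mathcal{M}_4)^\top=g(\rho)\gamma\bm{u}$ with $\rho=u_1^2+u_3^2-u_2^2-u_4^2$ and $g(\rho)=m-(\kappa+1)\lambda\rho^\kappa$. The constants satisfy $m\ge0$, $\lambda\ge0$, $\kappa>0$ (real powers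 are used only where they are defined: if $\kappa$ is not an integer, $\rho\ge 0$ is understood). The constant matrices are, in $2\times2$ blocks, $$\alpha=\begin{pmatrix}\sigma_1&0\\0&\sigma_1\end{pmatrix},\quad \beta=\begin{pmatrix}0&\mathrm{i}\sigma_2\\-\mathrm{i}\sigma_2&0\end{pmatrix},\quad \gamma=\begin{pmatrix}0&\sigma_3\\-\sigma_3&0\end{pmatrix},$$ $$\sigma_1=\begin{pmatrix}0&1\\1&0\end{pmatrix},\quad \sigma_2=\begin{pmatrix}0&-\mathrm{i}\\\mathrm{i}&0\end{pmatrix},\quad \sigma_3=\begin{pmatrix}1&0\\0&-1\end{pmatrix}.$$ Discrete setting: $\mathcal{V}_h=\{\phi\in L^2(\Omega):\ \phi|_{\mathcal{K}}\in\mathcal{P}^q(\mathcal{K})\ \forall\mathcal{K}\in\mathcal{T}_h\}$, where $\mathcal{P}^q(\mathcal{K})$ is the space of real polynomials on $\mathcal{K}$ of degree at most $q$. The partition is conforming: each edge $e$ of an element $\mathcal{K}$ either lies in $\partial\Omega$ or is a common edge $e=\mathcal{K}\cap\mathcal{K}'$ with exactly one neighbouring element $\mathcal{K}'$. $\bm{n}_{e\mathcal{K}}$ is the outward unit normal (a row vector) to the edge $e$ of $\mathcal{K}$. On an edge $e$ of $\mathcal{K}$, $\bm{u}_h^-$ and $v^-$ are the limits taken from the interior of $\mathcal{K}$; $\bm{u}_h^+$ is the limit taken from the neighbouring element $\mathcal{K}'$ if $e$ is an interior edge, and is the prescribed boundary value if $e\subset\partial\Omega$. All integrals in the scheme are exact.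 *)

theory Defs
  imports "HOL-Analysis.Analysis"
begin

section \<open>The Dirac system in real form\<close>

definition sigma1 :: "complex^2^2" where
  "sigma1 = vector [vector [0, 1], vector [1, 0]]"

definition sigma2 :: "complex^2^2" where
  "sigma2 = vector [vector [0, - \<i>], vector [\<i>, 0]]"

definition sigma3 :: "complex^2^2" where
  "sigma3 = vector [vector [1, 0], vector [0, - 1]]"

definition block :: "'a::zero^2^2 \<Rightarrow> 'a^2^2 \<Rightarrow> 'a^2^2 \<Rightarrow> 'a^2^2 \<Rightarrow> 'a^4^4" where
  "block A B C D = vector
     [vector [A$1$1, A$1$2, B$1$1, B$1$2],
      vector [A$2$1, A$2$2, B$2$1, B$2$2],
      vector [C$1$1, C$1$2, D$1$1, D$1$2],
      vector [C$2$1, C$2$2, D$2$1, D$2$2]]"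

text \<open>The block matrices below have real entries, so \<open>Re\<close> is only a change of type
  (see \<open>alpha_eq\<close>, \<open>beta_eq\<close>, \<open>gamma_eq\<close>).\<close>

definition alpha :: "real^4^4" where
  "alpha = map_matrix Re (block sigma1 0 0 sigma1)"

definition beta :: "real^4^4" where
  "beta = map_matrix Re (block 0 (map_matrix ((*) \<i>) sigma2) (- map_matrix ((*) \<i>) sigma2) 0)"

definition gamma :: "real^4^4" where
  "gamma = map_matrix Re (block 0 sigma3 (- sigma3) 0)"

lemma vector_4_nth:
  "(vector [a, b, c, d] :: 'a::zero^4) $ 1 = a"
  "(vector [a, b, c, d] :: 'a::zero^4) $ 2 = b"
  "(vector [a, b, c, d] :: 'a::zero^4) $ 3 = c"
  "(vector [a, b, c, d] :: 'a::zero^4) $ 4 = d"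
  by (simp_all add: vector_def)

lemma alpha_eq:
  "alpha = vector [vector [0, 1, 0, 0], vector [1, 0, 0, 0],
                   vector [0, 0, 0, 1], vector [0, 0, 1, 0]]"
  by (simp add: alpha_def block_def sigma1_def map_matrix_def vec_eq_iff forall_4 vector_4_nth)

lemma beta_eq:
  "beta = vector [vector [0, 0, 0, 1], vector [0, 0, - 1, 0],
                  vector [0, - 1, 0, 0], vector [1, 0, 0, 0]]"
  by (simp add: beta_def block_def sigma2_def map_matrix_def vec_eq_iff forall_4 vector_4_nth)

lemma gamma_eq:
  "gamma = vector [vector [0, 0, 1, 0], vector [0, 0, 0, - 1],
                   vector [- 1, 0, 0, 0], vector [0, 1, 0, 0]]"
  by (simp add: gamma_def block_def sigma3_def map_matrix_def vec_eq_iff forall_4 vector_4_nth)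

definition flux :: "real^4 \<Rightarrow> real^2^4" where
  "flux w = (\<chi> l. vector [(alpha *v w) $ l, (beta *v w) $ l])"

definition rho :: "real^4 \<Rightarrow> real" where
  "rho w = (w$1)\<^sup>2 + (w$3)\<^sup>2 - (w$2)\<^sup>2 - (w$4)\<^sup>2"

text \<open>For positive integer exponents this is the usual power, also of a negative base; for other
  positive exponents it is meant for nonnegative bases only (with \<open>0 powr k = 0\<close>).\<close>

definition real_pow :: "real \<Rightarrow> real \<Rightarrow> real" where
  "real_pow r k = (if k \<in> \<int> then r ^ nat \<lfloor>k\<rfloor> else r powr k)"

definition gfun :: "real \<Rightarrow> real \<Rightarrow> real \<Rightarrow> real \<Rightarrow> real" where
  "gfun m lam kap r = m - (kap + 1) * lam * real_pow r kap"

definition source :: "real \<Rightarrow> real \<Rightarrow> real \<Rightarrow> real^4 \<Rightarrow> real^4" where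
  "source m lam kap w = gfun m lam kap (rho w) *\<^sub>R (gamma *v w)"


section \<open>Meshes\<close>

definition polygonal_domain :: "(real^2) set \<Rightarrow> bool" where
  "polygonal_domain \<Omega> \<longleftrightarrow>
     open \<Omega> \<and> connected \<Omega> \<and> \<Omega> \<noteq> {} \<and>
     (\<exists>S. finite S \<and> frontier \<Omega> = \<Union>S \<and> (\<forall>s\<in>S. \<exists>a b. a \<noteq> b \<and> s = closed_segment a b))"

definition triangle :: "(real^2) set \<Rightarrow> bool" where
  "triangle K \<longleftrightarrow> (\<exists>a b c. \<not> collinear {a, b, c} \<and> K = convex hull {a, b, c})"

definition rectangle :: "(real^2) set \<Rightarrow> bool" where
  "rectangle K \<longleftrightarrow> (\<exists>a v w. v \<noteq> 0 \<and> w \<noteq> 0 \<and> v \<bullet> w = 0 \<and>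
     K = convex hull {a, a + v, a + w, a + v + w})"

definition neighbour_at :: "(real^2) set set \<Rightarrow> (real^2) set \<Rightarrow> (real^2) set \<Rightarrow> (real^2) set \<Rightarrow> bool"
  where "neighbour_at T K e K' \<longleftrightarrow> K' \<in> T \<and> K' \<noteq> K \<and> e edge_of K' \<and> e = K \<inter> K'"

text \<open>Elements are closed sets; they partition \<open>\<Omega>\<close> up to their boundaries.\<close>

definition conforming_mesh :: "(real^2) set \<Rightarrow> (real^2) set set \<Rightarrow> bool" where
  "conforming_mesh \<Omega> T \<longleftrightarrow>
     finite T \<and> (\<forall>K\<in>T. triangle K \<or> rectangle K) \<and>
     \<Union>T = closure \<Omega> \<and> (\<forall>K\<in>T. interior K \<subseteq> \<Omega>) \<and>
     (\<forall>K\<in>T. \<forall>K'\<in>T. K \<noteq> K' \<longrightarrow> interior K \<inter> interior K' = {}) \<and>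
     (\<forall>K\<in>T. \<forall>e. e edge_of K \<longrightarrow> e \<subseteq> frontier \<Omega> \<or> (\<exists>!K'. neighbour_at T K e K'))"

definition outward_normal :: "(real^2) set \<Rightarrow> (real^2) set \<Rightarrow> real^2" where
  "outward_normal K e = (THE n. norm n = 1 \<and>
     (\<forall>x\<in>e. \<forall>y\<in>e. n \<bullet> (y - x) = 0) \<and> (\<forall>x\<in>e. \<forall>y\<in>K. n \<bullet> (y - x) \<le> 0))"

text \<open>The integral over a segment with respect to arc length. It does not depend on the choice of
  the end points (see \<open>edge_integral_segment\<close>).\<close>

definition edge_integral :: "(real^2) set \<Rightarrow> (real^2 \<Rightarrow> real) \<Rightarrow> real" where
  "edge_integral e \<phi> = (let (a, b) = (SOME (a, b). e = closed_segment a b)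
     in dist a b * (LINT s:{0..1}|lebesgue. \<phi> (linepath a b s)))"

lemma lebesgue_integral_reverse:
  fixes f :: "real \<Rightarrow> real"
  shows "(LINT s:{0..1}|lebesgue. f (1 - s)) = (LINT s:{0..1}|lebesgue. f s)"
proof -
  have "(LINT s:{0..1}|lebesgue. f s)
      = \<bar>- 1\<bar> *\<^sub>R (LINT s|lebesgue. indicator {0..1} (1 + - 1 * s) *\<^sub>R f (1 + - 1 * s))"
    unfolding set_lebesgue_integral_def by (rule lebesgue_integral_real_affine) simp
  also have "\<dots> = (LINT s:{0..1}|lebesgue. f (1 - s))"
    unfolding set_lebesgue_integral_def
    by (auto intro!: Bochner_Integration.integral_cong simp: indicator_def)
  finally show ?thesis ..
qed

lemma edge_integral_segment:
  "edge_integral (closed_segment a b) \<phi> =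
     dist a b * (LINT s:{0..1}|lebesgue. \<phi> (linepath a b s))"
proof -
  obtain c d where cd: "(SOME (c, d). closed_segment a b = closed_segment c d) = (c, d)"
    by fastforce
  have "case (SOME (c, d). closed_segment a b = closed_segment c d) of
      (c, d) \<Rightarrow> closed_segment a b = closed_segment c d"
    by (rule someI [of _ "(a, b)"]) simp
  then have "closed_segment a b = closed_segment c d"
    using cd by simp
  then consider "c = a" "d = b" | "c = b" "d = a"
    by (auto simp: closed_segment_eq doubleton_eq_iff)
  then show ?thesis
  proof cases
    case 1
    then show ?thesis using cd by (simp add: edge_integral_def)
  next
    case 2
    have "linepath b a s = linepath a b (1 - s)" for s
      by (simp add: linepath_def)
    then show ?thesis
      using cd 2 lebesgue_integral_reverse [of "\<lambda>s. \<phi> (linepath a b s)"]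
      by (simp add: edge_integral_def dist_commute)
  qed
qed


section \<open>The discontinuous Galerkin scheme\<close>

definition poly_space :: "nat \<Rightarrow> (real^2 \<Rightarrow> real) set" where
  "poly_space q = {p. \<exists>c :: nat \<Rightarrow> nat \<Rightarrow> real.
     \<forall>x. p x = (\<Sum>i\<le>q. \<Sum>j\<le>q - i. c i j * (x$1) ^ i * (x$2) ^ j)}"

text \<open>Elements of \<open>L\<^sup>2(\<Omega>)\<close> are represented by functions that are polynomial at every interior
  point of each element. Their values on the (negligible) element boundaries are arbitrary.\<close>

definition dg_space :: "(real^2) set \<Rightarrow> (real^2) set set \<Rightarrow> nat \<Rightarrow> (real^2 \<Rightarrow> real) set" where
  "dg_space \<Omega> T q = {\<phi>.
     \<phi> \<in> borel_measurable (lebesgue_on \<Omega>) \<and> integrable (lebesgue_on \<Omega>) (\<lambda>x. (\<phi> x)\<^sup>2) \<and>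
     (\<forall>K\<in>T. \<exists>p\<in>poly_space q. \<forall>x\<in>interior K. \<phi> x = p x)}"

definition trace_in :: "(real^2) set \<Rightarrow> (real^2 \<Rightarrow> 'a::t2_space) \<Rightarrow> real^2 \<Rightarrow> 'a" where
  "trace_in K \<phi> x = Lim (at x within interior K) \<phi>"

definition trace_out :: "(real^2) set \<Rightarrow> (real^2) set set \<Rightarrow> (real^2 \<Rightarrow> real^4) \<Rightarrow>
    (real^2) set \<Rightarrow> (real^2) set \<Rightarrow> (real^2 \<Rightarrow> real^4) \<Rightarrow> real^2 \<Rightarrow> real^4" where
  "trace_out \<Omega> T bdry K e w x =
     (if e \<subseteq> frontier \<Omega> then bdry x else trace_in (THE K'. neighbour_at T K e K') w x)"

definition lax_friedrichs :: "real^2 \<Rightarrow> real^4 \<Rightarrow> real^4 \<Rightarrow> real^4" where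
  "lax_friedrichs n wm wp = (1/2) *\<^sub>R (flux wm *v n + flux wp *v n - (wp - wm))"

definition grad :: "(real^2 \<Rightarrow> real) \<Rightarrow> real^2 \<Rightarrow> real^2" where
  "grad \<phi> x = (\<chi> i. frechet_derivative \<phi> (at x) (axis i 1))"

definition time_deriv :: "(real \<Rightarrow> real^2 \<Rightarrow> real^4) \<Rightarrow> real \<Rightarrow> real^2 \<Rightarrow> real^4" where
  "time_deriv u t x = vector_derivative (\<lambda>s. u s x) (at t within {0..})"

definition dg_scheme :: "(real^2) set \<Rightarrow> (real^2) set set \<Rightarrow> nat \<Rightarrow> real \<Rightarrow> real \<Rightarrow> real \<Rightarrow>
    (real \<Rightarrow> real^2 \<Rightarrow> real^4) \<Rightarrow> (real \<Rightarrow> real^2 \<Rightarrow> real^4) \<Rightarrow> bool" where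
  "dg_scheme \<Omega> T q m lam kap bdry u \<longleftrightarrow>
     (\<forall>t\<ge>0. \<forall>K\<in>T. \<forall>l. \<forall>v\<in>dg_space \<Omega> T q.
        (LINT x:K|lebesgue. time_deriv u t x $ l * v x) =
        - (\<Sum>e | e edge_of K. edge_integral e (\<lambda>x.
              lax_friedrichs (outward_normal K e)
                (trace_in K (u t) x) (trace_out \<Omega> T (bdry t) K e (u t) x) $ l
              * trace_in K v x))
        + (LINT x:K|lebesgue.
              flux (u t x) $ l \<bullet> grad v x + source m lam kap (u t x) $ l * v x))"

text \<open>Differentiability in \<open>t\<close> is one-sided at \<open>t = 0\<close>. The third clause makes the power of \<open>rho\<close> well
  defined when the exponent is not an integer.\<close>

definition dg_solution :: "(real^2) set \<Rightarrow> (real^2) set set \<Rightarrow> nat \<Rightarrow> real \<Rightarrow> real \<Rightarrow> real \<Rightarrow>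
    (real \<Rightarrow> real^2 \<Rightarrow> real^4) \<Rightarrow> (real \<Rightarrow> real^2 \<Rightarrow> real^4) \<Rightarrow> bool" where
  "dg_solution \<Omega> T q m lam kap bdry u \<longleftrightarrow>
     (\<forall>t\<ge>0. \<forall>l. (\<lambda>x. u t x $ l) \<in> dg_space \<Omega> T q) \<and>
     (\<forall>t\<ge>0. \<forall>K\<in>T. \<forall>x\<in>interior K. (\<lambda>s. u s x) differentiable (at t within {0..})) \<and>
     (kap \<notin> \<int> \<longrightarrow> (\<forall>t\<ge>0. \<forall>K\<in>T. \<forall>x\<in>interior K. 0 \<le> rho (u t x))) \<and>
     dg_scheme \<Omega> T q m lam kap bdry u"

definition charge :: "(real^2) set \<Rightarrow> (real \<Rightarrow> real^2 \<Rightarrow> real^4) \<Rightarrow> real \<Rightarrow> ennreal" where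
  "charge \<Omega> u t = (\<integral>\<^sup>+ x\<in>\<Omega>. ennreal (\<Sum>l\<in>UNIV. \<bar>u t x $ l\<bar>\<^sup>2) \<partial>lebesgue)"

end

theory Submission
  imports Defs
begin

text \<open>Test the scheme on an element \<open>K\<close> with \<open>v = u\<^sub>l\<close> and sum over \<open>l\<close>. The left side is half the time
  derivative of the charge of \<open>K\<close>. The source drops out because \<open>gamma\<close> is antisymmetric, whatever the
  nonlinearity is. Because \<open>alpha\<close> and \<open>beta\<close> are symmetric, the volume flux term is the divergence of
  the field with components \<open>(u \<bullet> alpha u) / 2\<close> and \<open>(u \<bullet> beta u) / 2\<close>, so by the divergence theorem it
  equals the integral of \<open>(u\<^sup>- \<bullet> A u\<^sup>-) / 2\<close> over the edges, where \<open>A = n\<^sub>1 alpha + n\<^sub>2 beta\<close>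
  (\<open>volume_flux_eq_edge_flux\<close>). This cancels against the interior part of the numerical flux, and the
  derivative of the charge is minus twice the sum, over all pairs of an element and one of its
  edges, of the integral of
  \<open>d = (u\<^sup>- \<bullet> A u\<^sup>+ - u\<^sup>+ \<bullet> u\<^sup>- + u\<^sup>- \<bullet> u\<^sup>-) / 2\<close> (\<open>edge_dissipation\<close>, \<open>element_balance\<close>).

  On a boundary edge \<open>u\<^sup>+ = 0\<close> and \<open>d = (u\<^sup>- \<bullet> u\<^sup>-) / 2\<close>. An interior edge belongs to two pairs,
  with the traces exchanged and opposite normals: the two terms containing \<open>A\<close> cancel, and what
  remains is \<open>((u\<^sup>+ - u\<^sup>-) \<bullet> (u\<^sup>+ - u\<^sup>-)) / 2\<close>. Hence the sum is nonnegative
  (\<open>total_edge_dissipation_nonneg\<close>).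

  Three ingredients support this computation. The divergence theorem on triangles and rectangles is
  Fubini's theorem in affine coordinates along two sides of the element (\<open>element_boundary\<close>). That the
  two normals of an interior edge are opposite follows from the disjointness of the interiors of the
  elements (\<open>opposite_outward_normals\<close>). Finally, the solution is only known to be differentiable in
  time at each point; since it is a polynomial of degree at most \<open>q\<close> inside an element, it is a fixed
  combination of its values at finitely many points, and so the charge of the element is a quadratic
  form in finitely many differentiable functions of time (\<open>square_integral_has_derivative\<close>).\<close>

section \<open>Integrals in the plane\<close>

definition pt :: "real \<Rightarrow> real \<Rightarrow> real^2" where "pt s t = s *\<^sub>R axis 1 1 + t *\<^sub>R axis 2 1"

lemma pt_nth [simp]: "pt s t $ 1 = s" "pt s t $ 2 = t"
  by (simp_all add: pt_def axis_def)

lemma pt_measurable: "(\<lambda>z. pt (fst z) (snd z)) \<in> borel_measurable borel"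
  unfolding pt_def by (intro borel_measurable_continuous_onI continuous_intros)

text \<open>Lebesgue measure on \<open>real^2\<close> is the product measure in the two coordinates, since the two measures
  agree on boxes. This is what makes iterated integration available for functions on \<open>real^2\<close>.\<close>

lemma lborel_plane:
  "(lborel :: (real^2) measure) = distr lborel borel (\<lambda>z. pt (fst z) (snd z))"
proof (rule lborel_eqI)
  fix l u :: "real^2"
  assume lu: "\<And>b. b \<in> Basis \<Longrightarrow> l \<bullet> b \<le> u \<bullet> b"
  have le: "l $ i \<le> u $ i" for i
    using lu[of "axis i 1"] by (simp add: inner_axis)
  have vim: "(\<lambda>z. pt (fst z) (snd z)) -` box l u = {l$1<..<u$1} \<times> {l$2<..<u$2}"
    by (auto simp: mem_box_cart forall_2)
  have "emeasure (distr lborel borel (\<lambda>z. pt (fst z) (snd z))) (box l u)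
      = emeasure (lborel :: (real\<times>real) measure) ({l$1<..<u$1} \<times> {l$2<..<u$2})"
    by (subst emeasure_distr) (auto simp: vim pt_measurable)
  also have "\<dots> = ennreal (u$1 - l$1) * ennreal (u$2 - l$2)"
    by (simp add: lborel_prod[symmetric] lborel.emeasure_pair_measure_Times le)
  also have "\<dots> = ennreal (\<Prod>b\<in>Basis. (u - l) \<bullet> b)"
  proof -
    have "(\<Prod>b\<in>Basis. (u - l) \<bullet> b) = (u$1 - l$1) * (u$2 - l$2)"
      by (simp add: Basis_vec_def prod.UNION_disjoint axis_eq_axis UNIV_2 inner_axis)
    then show ?thesis by (simp add: le ennreal_mult)
  qed
  finally show "emeasure (distr lborel borel (\<lambda>z. pt (fst z) (snd z))) (box l u)
      = ennreal (\<Prod>b\<in>Basis. (u - l) \<bullet> b)" .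
qed simp

lemma integral_plane:
  fixes h :: "real^2 \<Rightarrow> real"
  assumes "integrable lborel h"
  shows "integral\<^sup>L lborel h = (\<integral>t. \<integral>s. h (pt s t) \<partial>lborel \<partial>lborel)"
proof -
  have m: "(\<lambda>z. pt (fst z) (snd z)) \<in> measurable lborel borel"
    using pt_measurable by simp
  have h: "h \<in> borel_measurable borel"
    using assms by auto
  have "integral\<^sup>L lborel h = (\<integral>z. h (pt (fst z) (snd z)) \<partial>(lborel :: (real\<times>real) measure))"
    by (subst lborel_plane, subst integral_distr[OF m h]) simp
  also have "\<dots> = integral\<^sup>L (lborel \<Otimes>\<^sub>M lborel) (\<lambda>(s, t). h (pt s t))"
    by (simp add: lborel_prod case_prod_unfold)
  also have "\<dots> = (\<integral>t. \<integral>s. h (pt s t) \<partial>lborel \<partial>lborel)"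
  proof (rule lborel_pair.integral_snd[symmetric])
    have "integrable (distr lborel borel (\<lambda>z. pt (fst z) (snd z))) h"
      using assms lborel_plane by simp
    then have "integrable (lborel :: (real\<times>real) measure) (\<lambda>z. h (pt (fst z) (snd z)))"
      by (subst (asm) integrable_distr_eq[OF m h])
    then show "integrable (lborel \<Otimes>\<^sub>M lborel) (\<lambda>(s, t). h (pt s t))"
      by (simp add: lborel_prod case_prod_unfold)
  qed
  finally show ?thesis .
qed

lemma absolutely_integrable_continuous_compact:
  fixes f :: "'a::euclidean_space \<Rightarrow> 'b::euclidean_space"
  assumes "compact S" "continuous_on S f"
  shows "f absolutely_integrable_on S"
proof -
  have "integrable lborel (\<lambda>x. indicator S x *\<^sub>R f x)"
    by (rule borel_integrable_compact[OF assms])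
  then show ?thesis
    unfolding set_integrable_def
    by (subst integrable_completion) auto
qed

text \<open>An instance of the change of variables formula for \<open>real^1\<close>-valued functions, transported to \<open>real\<close>.\<close>

lemma integral_affine_image:
  fixes f :: "real^2 \<Rightarrow> real" and a v w :: "real^2"
  defines "\<Phi> \<equiv> \<lambda>z::real^2. a + z$1 *\<^sub>R v + z$2 *\<^sub>R w"
  assumes det: "v$1 * w$2 - v$2 * w$1 \<noteq> 0" and R: "compact R"
    and f: "continuous_on (\<Phi> ` R) f"
  shows "integral (\<Phi> ` R) f = \<bar>v$1 * w$2 - v$2 * w$1\<bar> * integral R (\<lambda>z. f (\<Phi> z))"
proof -
  let ?A = "\<lambda>z::real^2. z$1 *\<^sub>R v + z$2 *\<^sub>R w"
  have lin: "linear ?A"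
    by (intro linearI) (auto simp: algebra_simps)
  have nth: "((\<lambda>z::real^2. z$i) has_derivative (\<lambda>z. z$i)) F" for i F
    by (rule bounded_linear_imp_has_derivative[OF bounded_linear_vec_nth])
  have der: "(\<Phi> has_derivative ?A) (at x within R)" for x
    unfolding \<Phi>_def by (auto intro!: derivative_eq_intros nth)
  have detA: "det (matrix ?A) = v$1 * w$2 - v$2 * w$1"
    by (simp add: det_2 matrix_def axis_def)
  have "inj \<Phi>"
  proof (rule injI)
    fix x y assume "\<Phi> x = \<Phi> y"
    then have "?A (x - y) = 0"
      by (simp add: \<Phi>_def algebra_simps)
    then have "matrix ?A *v (x - y) = 0"
      by (simp add: lin)
    moreover have "\<exists>B. B ** matrix ?A = mat 1"
      using det detA invertible_det_nz[of "matrix ?A"] unfolding invertible_def by auto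
    ultimately have "x - y = 0"
      unfolding matrix_left_invertible_ker by blast
    then show "x = y" by simp
  qed
  then have inj: "inj_on \<Phi> R"
    by (rule inj_on_subset) simp
  have cont: "continuous_on R \<Phi>"
    unfolding \<Phi>_def by (intro continuous_intros)
  have comp: "compact (\<Phi> ` R)"
    using cont R by (rule compact_continuous_image)
  have *: "integral (\<Phi> ` R) (\<lambda>x. vec (f x) :: real^1)
      = integral R (\<lambda>x. \<bar>det (matrix ?A)\<bar> *\<^sub>R vec (f (\<Phi> x)))"
  proof (rule integral_change_of_variables[OF _ der inj])
    show "R \<in> sets lebesgue"
      using R by (simp add: lmeasurable_compact fmeasurableD)
    show "(\<lambda>x. vec (f x) :: real^1) absolutely_integrable_on \<Phi> ` R \<or>
      (\<lambda>x. \<bar>det (matrix ?A)\<bar> *\<^sub>R (vec (f (\<Phi> x)) :: real^1)) absolutely_integrable_on R"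
      using absolutely_integrable_continuous_compact[OF comp f]
      by (simp add: absolutely_integrable_on_1_iff)
  qed
  then have "integral (\<Phi> ` R) f = integral R (\<lambda>x. \<bar>det (matrix ?A)\<bar> *\<^sub>R f (\<Phi> x))"
    by (simp add: integral_on_1_eq vec_eq_iff)
  then show ?thesis
    by (simp add: detA)
qed

section \<open>Functions with a continuous gradient\<close>

text \<open>Continuous differentiability with the gradient as an explicit second argument, so that the rules for
  sums and products compute it.\<close>

definition has_cont_grad :: "(real^2 \<Rightarrow> real) \<Rightarrow> (real^2 \<Rightarrow> real^2) \<Rightarrow> bool" where
  "has_cont_grad f g \<longleftrightarrow> (\<forall>x. (f has_derivative (\<lambda>h. g x \<bullet> h)) (at x)) \<and> continuous_on UNIV g"

lemma has_cont_grad_continuous_on: "has_cont_grad f g \<Longrightarrow> continuous_on S f"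
  unfolding has_cont_grad_def
  by (auto intro!: continuous_at_imp_continuous_on has_derivative_continuous)

lemma grad_eq_of_has_cont_grad: "has_cont_grad f g \<Longrightarrow> grad f x = g x"
proof -
  assume "has_cont_grad f g"
  then have "frechet_derivative f (at x) = (\<lambda>h. g x \<bullet> h)"
    by (intro frechet_derivative_at[symmetric]) (simp add: has_cont_grad_def)
  then show ?thesis
    by (simp add: grad_def vec_eq_iff inner_axis)
qed

lemma has_cont_grad_imp_grad: "has_cont_grad f g \<Longrightarrow> has_cont_grad f (grad f)"
  using grad_eq_of_has_cont_grad[of f g] by (metis ext)

lemma has_cont_grad_const: "has_cont_grad (\<lambda>x. c) (\<lambda>x. 0)"
  by (simp add: has_cont_grad_def)

lemma has_cont_grad_nth: "has_cont_grad (\<lambda>x. x $ i) (\<lambda>x. axis i 1)"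
  by (auto simp: has_cont_grad_def inner_axis' bounded_linear_imp_has_derivative bounded_linear_vec_nth)

lemma has_cont_grad_add:
  "has_cont_grad f f' \<Longrightarrow> has_cont_grad g g' \<Longrightarrow> has_cont_grad (\<lambda>x. f x + g x) (\<lambda>x. f' x + g' x)"
  by (auto simp: has_cont_grad_def inner_add_left intro!: has_derivative_add continuous_intros)

lemma has_cont_grad_mult:
  assumes f: "has_cont_grad f f'" and g: "has_cont_grad g g'"
  shows "has_cont_grad (\<lambda>x. f x * g x) (\<lambda>x. f x *\<^sub>R g' x + g x *\<^sub>R f' x)"
  unfolding has_cont_grad_def
proof
  show "continuous_on UNIV (\<lambda>x. f x *\<^sub>R g' x + g x *\<^sub>R f' x)"
    using f g has_cont_grad_continuous_on[OF f] has_cont_grad_continuous_on[OF g]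
    by (auto simp: has_cont_grad_def intro!: continuous_intros)
  show "\<forall>x. ((\<lambda>x. f x * g x) has_derivative (\<lambda>h. (f x *\<^sub>R g' x + g x *\<^sub>R f' x) \<bullet> h)) (at x)"
  proof
    fix x
    have "((\<lambda>x. f x * g x) has_derivative (\<lambda>h. f x * (g' x \<bullet> h) + (f' x \<bullet> h) * g x)) (at x)"
      using f g by (intro has_derivative_mult) (simp_all add: has_cont_grad_def)
    then show "((\<lambda>x. f x * g x) has_derivative (\<lambda>h. (f x *\<^sub>R g' x + g x *\<^sub>R f' x) \<bullet> h)) (at x)"
      by (simp add: inner_add_left mult.commute)
  qed
qed

lemma has_cont_grad_cmult: "has_cont_grad f f' \<Longrightarrow> has_cont_grad (\<lambda>x. c * f x) (\<lambda>x. c *\<^sub>R f' x)"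
  using has_cont_grad_mult[OF has_cont_grad_const[of c], of f f'] by simp

lemma has_cont_grad_sum:
  "(\<And>i. i \<in> I \<Longrightarrow> has_cont_grad (f i) (f' i)) \<Longrightarrow>
    has_cont_grad (\<lambda>x. \<Sum>i\<in>I. f i x) (\<lambda>x. \<Sum>i\<in>I. f' i x)"
  by (induction I rule: infinite_finite_induct) (auto intro: has_cont_grad_const has_cont_grad_add)

lemma has_cont_grad_power:
  assumes "has_cont_grad f f'"
  shows "\<exists>g. has_cont_grad (\<lambda>x. f x ^ n) g"
proof (induction n)
  case 0
  then show ?case using has_cont_grad_const[of 1] by auto
next
  case (Suc n)
  then show ?case using has_cont_grad_mult[OF assms] by (simp only: power_Suc) blast
qed

lemma poly_space_has_cont_grad:
  assumes "p \<in> poly_space q"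
  shows "has_cont_grad p (grad p)"
proof -
  obtain c where c: "p = (\<lambda>x. \<Sum>i\<le>q. \<Sum>j\<le>q - i. c i j * (x$1) ^ i * (x$2) ^ j)"
    using assms by (auto simp: poly_space_def)
  have "has_cont_grad (\<lambda>x. c i j * (x$1) ^ i * (x$2) ^ j) (grad (\<lambda>x. c i j * (x$1) ^ i * (x$2) ^ j))" for i j
  proof -
    obtain g1 where g1: "has_cont_grad (\<lambda>x. (x$1) ^ i) g1"
      using has_cont_grad_power[OF has_cont_grad_nth, of 1 i] by blast
    obtain g2 where g2: "has_cont_grad (\<lambda>x. (x$2) ^ j) g2"
      using has_cont_grad_power[OF has_cont_grad_nth, of 2 j] by blast
    show ?thesis
      by (rule has_cont_grad_imp_grad, rule has_cont_grad_mult[OF has_cont_grad_cmult[OF g1] g2])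
  qed
  then show ?thesis
    unfolding c by (intro has_cont_grad_imp_grad[OF has_cont_grad_sum[OF has_cont_grad_sum]])
qed

section \<open>The edges of triangles and rectangles\<close>

abbreviation element :: "(real^2) set \<Rightarrow> bool" where
  "element K \<equiv> triangle K \<or> rectangle K"

text \<open>The determinant with columns \<open>x\<close> and \<open>y\<close>. Its sign says on which side of the line through \<open>p\<close> with
  direction \<open>d\<close> a point \<open>y\<close> lies: \<open>cross2 d (y - p)\<close> is positive exactly on the left.\<close>

definition cross2 :: "real^2 \<Rightarrow> real^2 \<Rightarrow> real" where
  "cross2 x y = x$1 * y$2 - x$2 * y$1"

lemma cross2_simps:
  "cross2 (x + y) z = cross2 x z + cross2 y z" "cross2 z (x + y) = cross2 z x + cross2 z y"
  "cross2 (x - y) z = cross2 x z - cross2 y z" "cross2 z (x - y) = cross2 z x - cross2 z y"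
  "cross2 (c *\<^sub>R x) z = c * cross2 x z" "cross2 z (c *\<^sub>R x) = c * cross2 z x"
  "cross2 (- x) z = - cross2 x z" "cross2 z (- x) = - cross2 z x"
  by (simp_all add: cross2_def algebra_simps)

lemma cross2_triv [simp]: "cross2 x x = 0" "cross2 0 x = 0" "cross2 x 0 = 0"
  by (simp_all add: cross2_def)

lemma cross2_commute: "cross2 y x = - cross2 x y"
  by (simp add: cross2_def)

lemma cross2_eq_0_imp_scaled:
  assumes "cross2 x y = 0" "y \<noteq> 0"
  shows "\<exists>c. x = c *\<^sub>R y"
proof (cases "y$1 = 0")
  case True
  with assms(2) have "y$2 \<noteq> 0" by (auto simp: vec_eq_iff forall_2)
  then show ?thesis using assms(1) True
    by (intro exI[of _ "x$2 / y$2"]) (auto simp: vec_eq_iff forall_2 cross2_def)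
next
  case False
  then show ?thesis using assms(1)
    by (intro exI[of _ "x$1 / y$1"]) (auto simp: vec_eq_iff forall_2 cross2_def field_simps)
qed

lemma cross2_orthogonal_nonzero:
  assumes "v \<noteq> 0" "w \<noteq> 0" "v \<bullet> w = 0"
  shows "cross2 v w \<noteq> 0"
proof
  assume "cross2 v w = 0"
  then obtain k where "v = k *\<^sub>R w" using cross2_eq_0_imp_scaled assms(2) by blast
  then show False using assms by simp
qed

lemma cross2_eq_inner: "cross2 d z = pt (z$2) (- z$1) \<bullet> d"
  by (simp add: cross2_def inner_vec_def sum_2)

text \<open>Cramer's rule.\<close>

lemma cross2_basis:
  assumes "cross2 v w \<noteq> 0"
  shows "d = (cross2 d w / cross2 v w) *\<^sub>R v + (cross2 v d / cross2 v w) *\<^sub>R w"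
  using assms by (simp add: vec_eq_iff forall_2 divide_simps) (simp add: cross2_def algebra_simps)

lemma collinear_iff_cross2: "collinear {a, b, c} \<longleftrightarrow> cross2 (b - a) (c - a) = 0"
proof (cases "c = a")
  case True
  then show ?thesis by (simp add: insert_commute)
next
  case False
  show ?thesis
  proof
    assume "collinear {a, b, c}"
    then obtain u where "b = u *\<^sub>R a + (1 - u) *\<^sub>R c"
      using False by (auto simp: collinear_3_expand)
    then have "b - a = (1 - u) *\<^sub>R (c - a)" by (simp add: algebra_simps)
    then show "cross2 (b - a) (c - a) = 0" by (simp only: cross2_simps(5) cross2_triv mult_zero_right)
  next
    assume "cross2 (b - a) (c - a) = 0"
    with False obtain k where "b - a = k *\<^sub>R (c - a)"
      using cross2_eq_0_imp_scaled[of "b - a" "c - a"] by auto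
    then have "b = (1 - k) *\<^sub>R a + (1 - (1 - k)) *\<^sub>R c" by (simp add: algebra_simps)
    then show "collinear {a, b, c}" unfolding collinear_3_expand by blast
  qed
qed

lemma cross2_closed_segment:
  assumes "x \<in> closed_segment p q"
  shows "cross2 (q - p) (x - p) = 0"
proof -
  obtain u where "x = (1 - u) *\<^sub>R p + u *\<^sub>R q"
    using assms by (auto simp: closed_segment_def)
  then have "x - p = u *\<^sub>R (q - p)" by (simp add: algebra_simps)
  then show ?thesis by (simp only: cross2_simps(6) cross2_triv mult_zero_right)
qed

lemma convex_cross2_pos: "convex {y. 0 < cross2 d (y - p)}"
proof -
  have "{y. 0 < cross2 d (y - p)} = {y. pt (- d$2) (d$1) \<bullet> y > cross2 d p}"
    by (auto simp: cross2_def inner_vec_def sum_2 algebra_simps)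
  then show ?thesis by (simp add: convex_halfspace_gt)
qed

lemma convex_cross2_nonneg: "convex {y. 0 \<le> cross2 d (y - p)}"
proof -
  have "{y. 0 \<le> cross2 d (y - p)} = {y. pt (- d$2) (d$1) \<bullet> y \<ge> cross2 d p}"
    by (auto simp: cross2_def inner_vec_def sum_2 algebra_simps)
  then show ?thesis by (simp add: convex_halfspace_ge)
qed

text \<open>The line through \<open>p\<close> and \<open>q\<close> misses the hull of the other points, because all of these lie strictly
  on one side of it.\<close>

lemma side_edge_of_hull:
  assumes S: "finite S" "p \<in> S" "q \<in> S" and pq: "p \<noteq> q"
    and left: "\<And>r. r \<in> S - {p, q} \<Longrightarrow> 0 < cross2 (q - p) (r - p)"
  shows "closed_segment p q edge_of convex hull S"
proof -
  have "x \<notin> convex hull (S - {p, q})" if "x \<in> affine hull {p, q}" for x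
  proof
    assume "x \<in> convex hull (S - {p, q})"
    moreover have "convex hull (S - {p, q}) \<subseteq> {y. 0 < cross2 (q - p) (y - p)}"
      by (rule hull_minimal) (use left convex_cross2_pos in auto)
    moreover have "cross2 (q - p) (x - p) = 0"
      using that by (auto simp: affine_hull_2_alt cross2_simps(5,6))
    ultimately show False by auto
  qed
  then have "convex hull {p, q} face_of convex hull S"
    using S by (intro face_of_convex_hulls) auto
  moreover have "aff_dim (closed_segment p q) = 1"
    using pq by (simp add: segment_convex_hull aff_dim_convex_hull aff_dim_2)
  ultimately show ?thesis
    by (simp add: edge_of_def segment_convex_hull)
qed

text \<open>A face of a polytope is spanned by some of the vertices, and a face of dimension one cannot contain
  three points that are not collinear.\<close>

lemma edge_of_hull_imp_segment:
  fixes S :: "(real^2) set"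
  assumes S: "finite S" and e: "e edge_of convex hull S"
    and gen: "\<And>p q r. p \<in> S \<Longrightarrow> q \<in> S \<Longrightarrow> r \<in> S \<Longrightarrow> p \<noteq> q \<Longrightarrow> q \<noteq> r \<Longrightarrow> p \<noteq> r \<Longrightarrow> \<not> collinear {p, q, r}"
  obtains p q where "p \<in> S" "q \<in> S" "p \<noteq> q" "e = closed_segment p q"
proof -
  obtain S' where S': "S' \<subseteq> S" "e = convex hull S'"
    using e S face_of_convex_hull_subset[of S e] finite_imp_compact edge_of_def by metis
  have dim: "aff_dim S' = 1"
    using e S' by (simp add: edge_of_def aff_dim_convex_hull)
  then have col: "collinear S'"
    by (simp add: collinear_aff_dim)
  have "S' \<noteq> {}" using dim by auto
  then obtain p where p: "p \<in> S'" by blast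
  have "S' \<noteq> {p}" using dim by auto
  then obtain q where q: "q \<in> S'" "p \<noteq> q" using p by blast
  have "S' = {p, q}"
  proof (rule ccontr)
    assume "S' \<noteq> {p, q}"
    then obtain r where "r \<in> S'" "r \<noteq> p" "r \<noteq> q" using p q by blast
    moreover have "collinear {p, q, r}"
      by (rule collinear_subset[OF col]) (use p q \<open>r \<in> S'\<close> in auto)
    ultimately show False using gen[of p q r] S' p q by blast
  qed
  then show thesis using that p q S' by (auto simp: segment_convex_hull)
qed

text \<open>The edges of \<open>K\<close>, each listed once by its end points in counterclockwise order: \<open>K\<close> lies to the left
  of every edge. With this orientation the outward normal of the edge from \<open>p\<close> to \<open>q\<close> has the
  direction of \<open>q - p\<close> turned clockwise by a right angle.\<close>

definition oriented_boundary :: "(real^2) set \<Rightarrow> ((real^2) \<times> (real^2)) set \<Rightarrow> bool" where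
  "oriented_boundary K E \<longleftrightarrow> finite E \<and>
     bij_betw (\<lambda>(p, q). closed_segment p q) E {e. e edge_of K} \<and>
     (\<forall>(p, q)\<in>E. p \<noteq> q \<and> (\<forall>y\<in>K. 0 \<le> cross2 (q - p) (y - p)))"

lemma oriented_boundary_triangle:
  assumes J: "0 < cross2 (b - a) (c - a)"
  shows "oriented_boundary (convex hull {a, b, c}) {(a, b), (b, c), (c, a)}"
proof -
  let ?K = "convex hull {a, b, c}"
  have dist: "a \<noteq> b" "b \<noteq> c" "c \<noteq> a"
    using J by auto
  have pos: "0 < cross2 (b - a) (c - a)" "0 < cross2 (c - b) (a - b)" "0 < cross2 (a - c) (b - c)"
    using J by (auto simp: cross2_def algebra_simps)
  have "{e. e edge_of ?K} = {closed_segment a b, closed_segment b c, closed_segment c a}"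
  proof (intro equalityI subsetI)
    fix e assume "e \<in> {e. e edge_of ?K}"
    then have "e edge_of ?K" by simp
    then obtain p q where "p \<in> {a, b, c}" "q \<in> {a, b, c}" "p \<noteq> q" "e = closed_segment p q"
    proof (rule edge_of_hull_imp_segment[rotated])
      fix p q r assume "p \<in> {a, b, c}" "q \<in> {a, b, c}" "r \<in> {a, b, c}" "p \<noteq> q" "q \<noteq> r" "p \<noteq> r"
      then have "{p, q, r} = {a, b, c}" by auto
      then show "\<not> collinear {p, q, r}" using J by (simp add: collinear_iff_cross2)
    qed auto
    then show "e \<in> {closed_segment a b, closed_segment b c, closed_segment c a}"
      by (auto simp: insert_commute)
  next
    fix e assume "e \<in> {closed_segment a b, closed_segment b c, closed_segment c a}"
    then show "e \<in> {e. e edge_of ?K}"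
      using dist pos by (auto intro!: side_edge_of_hull)
  qed
  moreover have "0 \<le> cross2 (q - p) (y - p)" if "(p, q) \<in> {(a, b), (b, c), (c, a)}" "y \<in> ?K" for p q y
  proof -
    have "?K \<subseteq> {y. 0 \<le> cross2 (q - p) (y - p)}"
      by (rule hull_minimal)
         (use that(1) pos in \<open>auto simp: convex_cross2_nonneg intro: less_imp_le\<close>)
    then show ?thesis using that(2) by blast
  qed
  ultimately show ?thesis
    using dist by (auto simp: oriented_boundary_def bij_betw_def doubleton_eq_iff)
qed

text \<open>Besides the four sides, two further segments join vertices, namely the diagonals. A diagonal is not a
  face, because its midpoint lies strictly inside the other diagonal, whose end points it misses.\<close>

lemma oriented_boundary_parallelogram:
  assumes J: "0 < cross2 v w"
  shows "oriented_boundary (convex hull {a, a + v, a + w, a + v + w})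
    {(a, a + v), (a + v, a + v + w), (a + v + w, a + w), (a + w, a)}"
proof -
  let ?S = "{a, a + v, a + w, a + v + w}"
  let ?K = "convex hull ?S"
  let ?E = "{(a, a + v), (a + v, a + v + w), (a + v + w, a + w), (a + w, a)}"
  have nz: "v \<noteq> 0" "w \<noteq> 0" "v \<noteq> w" "v + w \<noteq> 0"
    using J by (auto simp: cross2_def add_eq_0_iff)
  have wv: "cross2 w v = - cross2 v w" by (rule cross2_commute)
  have gen: "\<not> collinear {p, q, r}" if "p \<in> ?S" "q \<in> ?S" "r \<in> ?S" "p \<noteq> q" "q \<noteq> r" "p \<noteq> r" for p q r
    using that J nz by (auto simp: collinear_iff_cross2 cross2_def algebra_simps)
  have face: "b \<in> closed_segment p q"
    if "closed_segment p q edge_of ?K" "b \<in> ?S" "d \<in> ?S" "b \<noteq> d" "p + q = b + d" for p q b d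
  proof -
    have "midpoint b d \<in> closed_segment p q"
      using that(5) midpoint_in_closed_segment[of p q] by (simp add: midpoint_def)
    moreover have "midpoint b d \<in> open_segment b d"
      using that(4) by (simp add: midpoint_in_open_segment)
    moreover have "b \<in> ?K" "d \<in> ?K" using that(2,3) by (auto intro: hull_inc)
    ultimately show ?thesis
      using that(1) unfolding edge_of_def face_of_def by blast
  qed
  have image: "{e. e edge_of ?K} = (\<lambda>(p, q). closed_segment p q) ` ?E"
  proof (intro equalityI subsetI)
    fix e assume "e \<in> {e. e edge_of ?K}"
    then have e: "e edge_of ?K" by simp
    then obtain p q where pq: "p \<in> ?S" "q \<in> ?S" "p \<noteq> q" "e = closed_segment p q"
      by (rule edge_of_hull_imp_segment[rotated]) (use gen in auto)
    have "e \<noteq> closed_segment a (a + v + w)"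
    proof
      assume "e = closed_segment a (a + v + w)"
      then have "a + v \<in> closed_segment a (a + v + w)"
        using e nz by (intro face[where d = "a + w"]) (auto simp: algebra_simps)
      then have "cross2 (v + w) v = 0"
        using cross2_closed_segment[of "a + v" a "a + v + w"] by (simp add: add.assoc)
      then show False using J by (simp add: cross2_def algebra_simps)
    qed
    moreover have "e \<noteq> closed_segment (a + v) (a + w)"
    proof
      assume "e = closed_segment (a + v) (a + w)"
      then have "a \<in> closed_segment (a + v) (a + w)"
        using e nz by (intro face[where d = "a + v + w"]) (auto simp: algebra_simps)
      then have "cross2 (w - v) (- v) = 0"
        using cross2_closed_segment[of a "a + v" "a + w"] by simp
      then show False using J by (simp add: cross2_def algebra_simps)
    qed
    ultimately show "e \<in> (\<lambda>(p, q). closed_segment p q) ` ?E"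
      using pq by (elim insertE emptyE) (simp_all add: insert_commute)
  next
    fix e assume "e \<in> (\<lambda>(p, q). closed_segment p q) ` ?E"
    then show "e \<in> {e. e edge_of ?K}"
      using nz J by (auto intro!: side_edge_of_hull simp: cross2_def algebra_simps)
  qed
  have left: "0 \<le> cross2 (q - p) (y - p)" if "(p, q) \<in> ?E" "y \<in> ?K" for p q y
  proof -
    have "?S \<subseteq> {y. 0 \<le> cross2 (q - p) (y - p)}"
      using that(1) J by (auto simp: cross2_def algebra_simps)
    then have "?K \<subseteq> {y. 0 \<le> cross2 (q - p) (y - p)}"
      by (rule hull_minimal) (rule convex_cross2_nonneg)
    then show ?thesis using that(2) by blast
  qed
  have inj: "inj_on (\<lambda>(p, q). closed_segment p q) ?E"
    using nz by (auto simp: inj_on_def doubleton_eq_iff algebra_simps)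
  have neq: "p \<noteq> q" if "(p, q) \<in> ?E" for p q
    using that nz by auto
  show ?thesis
    unfolding oriented_boundary_def bij_betw_def
  proof (intro conjI inj image[symmetric])
    show "\<forall>(p, q)\<in>?E. p \<noteq> q \<and> (\<forall>y\<in>?K. 0 \<le> cross2 (q - p) (y - p))"
      using left neq by blast
  qed simp
qed

section \<open>The divergence theorem on an element\<close>

text \<open>The set \<open>K\<close> is a parallelogram for \<open>c = 0\<close> and a triangle for \<open>c = 1\<close>. In the affine coordinates
  \<open>(s, t)\<close> the derivative along \<open>v\<close> is \<open>\<partial>/\<partial>s\<close>, so integrating first over \<open>s\<close> and then over \<open>t\<close> leaves
  the difference of \<open>f\<close> at the two ends of the slices.\<close>

lemma integral_directional_derivative:
  fixes a v w :: "real^2" and c :: real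
  defines "J \<equiv> v$1 * w$2 - v$2 * w$1"
  assumes fg: "has_cont_grad f g" and J: "J \<noteq> 0" and c: "0 \<le> c" "c \<le> 1"
    and K: "K = {a + s *\<^sub>R v + t *\<^sub>R w | s t. 0 \<le> t \<and> t \<le> 1 \<and> 0 \<le> s \<and> s \<le> 1 - c * t}"
  shows "integral K (\<lambda>x. g x \<bullet> v) =
    \<bar>J\<bar> * (integral {0..1} (\<lambda>t. f (a + (1 - c * t) *\<^sub>R v + t *\<^sub>R w))
          - integral {0..1} (\<lambda>t. f (a + t *\<^sub>R w)))"
proof -
  define R :: "(real^2) set" where "R = {z. 0 \<le> z$2 \<and> z$2 \<le> 1 \<and> 0 \<le> z$1 \<and> z$1 \<le> 1 - c * z$2}"
  define \<Phi> where "\<Phi> = (\<lambda>z::real^2. a + z$1 *\<^sub>R v + z$2 *\<^sub>R w)"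
  have der: "(f has_derivative (\<lambda>h. g x \<bullet> h)) (at x)" for x
    using fg by (simp add: has_cont_grad_def)
  have contg: "continuous_on S (\<lambda>x. g (\<phi> x) \<bullet> v)" if "continuous_on S \<phi>" for S :: "'z::topological_space set" and \<phi>
  proof -
    have "continuous_on UNIV g" using fg by (simp add: has_cont_grad_def)
    then have "continuous_on S (\<lambda>x. g (\<phi> x))"
      by (rule continuous_on_compose2[OF _ that]) simp
    then show ?thesis by (intro continuous_intros)
  qed
  have contf: "continuous_on S (\<lambda>x. f (\<phi> x))" if "continuous_on S \<phi>" for S :: "'z::topological_space set" and \<phi>
    by (rule continuous_on_compose2[OF has_cont_grad_continuous_on[OF fg, of UNIV] that]) simp
  have KR: "K = \<Phi> ` R"
  proof (intro equalityI subsetI)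
    fix x assume "x \<in> K"
    then obtain s t where st: "x = a + s *\<^sub>R v + t *\<^sub>R w" "0 \<le> t" "t \<le> 1" "0 \<le> s" "s \<le> 1 - c * t"
      unfolding K by blast
    then have "x = \<Phi> (pt s t)" "pt s t \<in> R"
      by (auto simp: \<Phi>_def R_def)
    then show "x \<in> \<Phi> ` R" by blast
  next
    fix x assume "x \<in> \<Phi> ` R"
    then show "x \<in> K" unfolding K \<Phi>_def R_def by blast
  qed
  have "closed R"
    unfolding R_def by (intro closed_Collect_conj closed_Collect_le continuous_intros)
  moreover have "R \<subseteq> cbox 0 (pt 1 1)"
  proof
    fix z assume z: "z \<in> R"
    then have "0 \<le> c * z$2" using c by (simp add: R_def)
    with z show "z \<in> cbox 0 (pt 1 1)"
      by (simp add: R_def mem_box_cart forall_2)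
  qed
  ultimately have R: "compact R"
    by (meson bounded_cbox bounded_subset compact_eq_bounded_closed)
  have c\<Phi>: "continuous_on S \<Phi>" for S
    unfolding \<Phi>_def by (intro continuous_intros)
  let ?h = "\<lambda>z. g (\<Phi> z) \<bullet> v"
  have "integral K (\<lambda>x. g x \<bullet> v) = \<bar>J\<bar> * integral R ?h"
    unfolding KR \<Phi>_def J_def
    by (rule integral_affine_image[OF J[unfolded J_def] R]) (rule contg[OF continuous_on_id])
  also have "integral R ?h = (LINT z:R|lborel. ?h z)"
    using borel_integrable_compact[OF R contg[OF c\<Phi>]]
    by (intro set_borel_integral_eq_integral(2)[symmetric]) (simp add: set_integrable_def)
  also have "\<dots> = (\<integral>t. \<integral>s. indicator R (pt s t) *\<^sub>R ?h (pt s t) \<partial>lborel \<partial>lborel)"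
    unfolding set_lebesgue_integral_def
    by (rule integral_plane) (rule borel_integrable_compact[OF R contg[OF c\<Phi>]])
  also have "\<dots> = (\<integral>t. indicator {0..1} t *\<^sub>R (f (a + (1 - c * t) *\<^sub>R v + t *\<^sub>R w) - f (a + t *\<^sub>R w)) \<partial>lborel)"
  proof (rule Bochner_Integration.integral_cong[OF refl])
    fix t :: real
    show "(\<integral>s. indicator R (pt s t) *\<^sub>R ?h (pt s t) \<partial>lborel)
      = indicator {0..1} t *\<^sub>R (f (a + (1 - c * t) *\<^sub>R v + t *\<^sub>R w) - f (a + t *\<^sub>R w))"
    proof (cases "t \<in> {0..1}")
      case True
      have ct: "0 \<le> 1 - c * t"
        using True c by (simp add: mult_le_one)
      have "(\<integral>s. indicator R (pt s t) *\<^sub>R ?h (pt s t) \<partial>lborel)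
        = (\<integral>s. indicator {0..1 - c * t} s *\<^sub>R (g (a + s *\<^sub>R v + t *\<^sub>R w) \<bullet> v) \<partial>lborel)"
        by (rule Bochner_Integration.integral_cong)
           (use True in \<open>auto simp: R_def \<Phi>_def indicator_def\<close>)
      also have "\<dots> = f (a + (1 - c * t) *\<^sub>R v + t *\<^sub>R w) - f (a + 0 *\<^sub>R v + t *\<^sub>R w)"
      proof (rule integral_FTC_atLeastAtMost[OF ct])
        fix s
        have "((\<lambda>s. f (a + s *\<^sub>R v + t *\<^sub>R w)) has_derivative (\<lambda>h. g (a + s *\<^sub>R v + t *\<^sub>R w) \<bullet> (h *\<^sub>R v)))
           (at s within {0..1 - c * t})"
          by (rule has_derivative_compose[OF _ der]) (auto intro!: derivative_eq_intros)
        then show "((\<lambda>s. f (a + s *\<^sub>R v + t *\<^sub>R w)) has_vector_derivative g (a + s *\<^sub>R v + t *\<^sub>R w) \<bullet> v)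
           (at s within {0..1 - c * t})"
          by (simp add: has_vector_derivative_def)
      qed (intro contg continuous_intros)
      finally show ?thesis using True by simp
    next
      case False
      then show ?thesis by (auto simp: R_def)
    qed
  qed
  also have "\<dots> = integral {0..1} (\<lambda>t. f (a + (1 - c * t) *\<^sub>R v + t *\<^sub>R w) - f (a + t *\<^sub>R w))"
    unfolding set_lebesgue_integral_def[symmetric]
    by (intro set_borel_integral_eq_integral(2), unfold set_integrable_def)
       (intro borel_integrable_compact contf continuous_intros compact_Icc)
  also have "\<dots> = integral {0..1} (\<lambda>t. f (a + (1 - c * t) *\<^sub>R v + t *\<^sub>R w))
          - integral {0..1} (\<lambda>t. f (a + t *\<^sub>R w))"
    by (intro integral_diff integrable_continuous_real contf continuous_intros)
  finally show ?thesis by simp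
qed

definition segment_mean :: "(real^2 \<Rightarrow> real) \<Rightarrow> real^2 \<Rightarrow> real^2 \<Rightarrow> real" where
  "segment_mean f p q = integral {0..1} (\<lambda>s. f (linepath p q s))"

lemma segment_mean_eq_lebesgue:
  assumes "continuous_on (closed_segment p q) f"
  shows "(LINT s:{0..1}|lebesgue. f (linepath p q s)) = segment_mean f p q"
  unfolding segment_mean_def
proof (rule set_lebesgue_integral_eq_integral(2), rule absolutely_integrable_continuous_real)
  show "continuous_on {0..1} (\<lambda>s. f (linepath p q s))"
    using assms by (rule continuous_on_compose2) (auto simp: linepath_in_path continuous_on_linepath)
qed

lemma edge_integral_eq_segment_mean:
  assumes "continuous_on (closed_segment p q) f"
  shows "edge_integral (closed_segment p q) f = norm (q - p) * segment_mean f p q"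
  using segment_mean_eq_lebesgue[OF assms] by (simp add: edge_integral_segment dist_norm norm_minus_commute)

lemma segment_mean_commute:
  assumes "continuous_on (closed_segment p q) f"
  shows "segment_mean f q p = segment_mean f p q"
proof -
  have "linepath q p s = linepath p q (1 - s)" for s
    by (simp add: linepath_def)
  then show ?thesis
    using lebesgue_integral_reverse[of "\<lambda>s. f (linepath p q s)"] assms
    by (simp add: segment_mean_eq_lebesgue closed_segment_commute flip: segment_mean_eq_lebesgue)
qed

text \<open>The divergence theorem for the fields \<open>f *\<^sub>R d\<close> with the fixed direction \<open>d\<close>: the number
  \<open>cross2 d (q - p)\<close> is the length of the edge from \<open>p\<close> to \<open>q\<close> times the normal component of \<open>d\<close>.\<close>

definition divergence_formula :: "(real^2) set \<Rightarrow> ((real^2) \<times> (real^2)) set \<Rightarrow> real^2 \<Rightarrow> bool" where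
  "divergence_formula K E d \<longleftrightarrow> (\<forall>f g. has_cont_grad f g \<longrightarrow>
     integral K (\<lambda>x. g x \<bullet> d) = (\<Sum>(p, q)\<in>E. cross2 d (q - p) * segment_mean f p q))"

text \<open>Both sides of the formula are linear in \<open>d\<close>, so it suffices to know it for a basis of the plane, for
  which the directions of two sides of the element are a good choice.\<close>

lemma divergence_formula_spanned:
  assumes "compact K" "cross2 v w \<noteq> 0" "divergence_formula K E v" "divergence_formula K E w"
  shows "divergence_formula K E d"
  unfolding divergence_formula_def
proof (intro allI impI)
  fix f g assume fg: "has_cont_grad f g"
  \<comment> \<open>the coordinates of \<open>d\<close> in the basis \<open>v\<close>, \<open>w\<close>\<close>
  define \<beta> \<gamma> where "\<beta> = cross2 d w / cross2 v w" and "\<gamma> = cross2 v d / cross2 v w"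
  have d: "d = \<beta> *\<^sub>R v + \<gamma> *\<^sub>R w"
    unfolding \<beta>_def \<gamma>_def by (rule cross2_basis) fact
  have int: "(\<lambda>x. g x \<bullet> z) integrable_on K" for z
  proof -
    have "continuous_on UNIV g" using fg by (simp add: has_cont_grad_def)
    then have "continuous_on K (\<lambda>x. g x \<bullet> z)"
      by (intro continuous_intros) (auto intro: continuous_on_subset)
    then show ?thesis
      using absolutely_integrable_continuous_compact[OF assms(1)] set_lebesgue_integral_eq_integral(1) by blast
  qed
  have "integral K (\<lambda>x. g x \<bullet> d) = \<beta> * integral K (\<lambda>x. g x \<bullet> v) + \<gamma> * integral K (\<lambda>x. g x \<bullet> w)"
    using int by (simp add: d inner_add_right integral_add integrable_on_mult_right)
  also have "\<dots> = (\<Sum>(p, q)\<in>E. cross2 d (q - p) * segment_mean f p q)"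
    using assms(3,4) fg
    by (simp add: divergence_formula_def d sum_distrib_left cross2_simps(1,5) distrib_right
        case_prod_unfold mult.assoc flip: sum.distrib)
  finally show "integral K (\<lambda>x. g x \<bullet> d) = (\<Sum>(p, q)\<in>E. cross2 d (q - p) * segment_mean f p q)" .
qed

lemma divergence_triangle:
  assumes J: "0 < cross2 (b - a) (c - a)"
  shows "divergence_formula (convex hull {a, b, c}) {(a, b), (b, c), (c, a)} d"
proof (rule divergence_formula_spanned)
  let ?K = "convex hull {a, b, c}"
  define v w where "v = b - a" and "w = c - a"
  have J': "0 < cross2 v w" using J by (simp add: v_def w_def)
  have wv: "cross2 w v = - cross2 v w" by (rule cross2_commute)
  have dist: "a \<noteq> b" "b \<noteq> c" "c \<noteq> a"
    using J by auto
  have bc: "b - a = v" "c - b = w - v" "a - c = - w"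
    by (simp_all add: v_def w_def)
  have hull3: "convex hull {a, b, c} =
      {a + s *\<^sub>R (b - a) + t *\<^sub>R (c - a) | s t. 0 \<le> t \<and> t \<le> 1 \<and> 0 \<le> s \<and> s \<le> 1 - 1 * t}" for b c :: "real^2"
    unfolding convex_hull_3_alt by (intro Collect_cong iff_exI) auto
  have K: "?K = {a + s *\<^sub>R v + t *\<^sub>R w | s t. 0 \<le> t \<and> t \<le> 1 \<and> 0 \<le> s \<and> s \<le> 1 - 1 * t}"
    "?K = {a + s *\<^sub>R w + t *\<^sub>R v | s t. 0 \<le> t \<and> t \<le> 1 \<and> 0 \<le> s \<and> s \<le> 1 - 1 * t}"
    using hull3[of b c] hull3[of c b] by (simp_all add: v_def w_def insert_commute)
  have lp: "a + (1 - 1 * t) *\<^sub>R v + t *\<^sub>R w = linepath b c t" "a + t *\<^sub>R w = linepath a c t"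
    "a + (1 - 1 * t) *\<^sub>R w + t *\<^sub>R v = linepath c b t" "a + t *\<^sub>R v = linepath a b t" for t
    by (simp_all add: v_def w_def linepath_def algebra_simps)
  show "compact ?K" by (simp add: finite_imp_compact_convex_hull)
  show "cross2 v w \<noteq> 0" using J' by simp
  have sym: "segment_mean f q p = segment_mean f p q" if "has_cont_grad f g" for f g p q
    using that by (intro segment_mean_commute has_cont_grad_continuous_on)
  have sum: "(\<Sum>(p, q)\<in>{(a, b), (b, c), (c, a)}. cross2 z (q - p) * segment_mean f p q)
    = cross2 z v * segment_mean f a b + cross2 z (w - v) * segment_mean f b c
      + cross2 z (- w) * segment_mean f c a" for f z
    using dist by (simp add: bc)
  show "divergence_formula ?K {(a, b), (b, c), (c, a)} v"
    unfolding divergence_formula_def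
  proof (intro allI impI)
    fix f g assume fg: "has_cont_grad f g"
    have "integral ?K (\<lambda>x. g x \<bullet> v) = cross2 v w * (segment_mean f b c - segment_mean f a c)"
      using integral_directional_derivative[OF fg _ _ _ K(1)] J' unfolding lp(1,2)
      by (simp add: segment_mean_def cross2_def)
    then show "integral ?K (\<lambda>x. g x \<bullet> v)
      = (\<Sum>(p, q)\<in>{(a, b), (b, c), (c, a)}. cross2 v (q - p) * segment_mean f p q)"
      using sym[OF fg, of a c] unfolding sum by (simp add: cross2_simps algebra_simps)
  qed
  show "divergence_formula ?K {(a, b), (b, c), (c, a)} w"
    unfolding divergence_formula_def
  proof (intro allI impI)
    fix f g assume fg: "has_cont_grad f g"
    have "integral ?K (\<lambda>x. g x \<bullet> w) = cross2 v w * (segment_mean f c b - segment_mean f a b)"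
      using integral_directional_derivative[OF fg _ _ _ K(2)] J' unfolding lp(3,4)
      by (simp add: segment_mean_def cross2_def mult.commute)
    then show "integral ?K (\<lambda>x. g x \<bullet> w)
      = (\<Sum>(p, q)\<in>{(a, b), (b, c), (c, a)}. cross2 w (q - p) * segment_mean f p q)"
      using sym[OF fg, of b c] unfolding sum by (simp add: wv cross2_simps algebra_simps)
  qed
qed

text \<open>The coordinate description has the shape that \<open>integral_directional_derivative\<close> asks for.\<close>

lemma convex_hull_parallelogram:
  fixes a v w :: "'a::real_vector"
  shows "convex hull {a, a + v, a + w, a + v + w} =
    {a + s *\<^sub>R v + t *\<^sub>R w | s t. 0 \<le> t \<and> t \<le> 1 \<and> 0 \<le> s \<and> s \<le> 1}" (is "convex hull ?S = ?P")
proof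
  have "\<exists>s t. x = a + s *\<^sub>R v + t *\<^sub>R w \<and> 0 \<le> t \<and> t \<le> 1 \<and> 0 \<le> s \<and> s \<le> 1" if mem: "x \<in> ?S" for x
  proof -
    consider "x = a + 0 *\<^sub>R v + 0 *\<^sub>R w" | "x = a + 1 *\<^sub>R v + 0 *\<^sub>R w"
      | "x = a + 0 *\<^sub>R v + 1 *\<^sub>R w" | "x = a + 1 *\<^sub>R v + 1 *\<^sub>R w"
      using mem by auto
    then show ?thesis by cases (metis zero_le_one order_refl)+
  qed
  then have "?S \<subseteq> ?P" by blast
  moreover have "convex ?P"
  proof (rule convexI)
    fix x y :: 'a and \<mu> \<nu> :: real
    assume xy: "x \<in> ?P" "y \<in> ?P" and \<mu>\<nu>: "0 \<le> \<mu>" "0 \<le> \<nu>" "\<mu> + \<nu> = 1"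
    then obtain s t s' t' where st: "x = a + s *\<^sub>R v + t *\<^sub>R w" "y = a + s' *\<^sub>R v + t' *\<^sub>R w"
      "s \<in> {0..1}" "t \<in> {0..1}" "s' \<in> {0..1}" "t' \<in> {0..1}" by auto
    have "\<mu> *\<^sub>R x + \<nu> *\<^sub>R y = (\<mu> + \<nu>) *\<^sub>R a + (\<mu> * s + \<nu> * s') *\<^sub>R v + (\<mu> * t + \<nu> * t') *\<^sub>R w"
      by (simp add: st algebra_simps)
    moreover have "\<mu> * s + \<nu> * s' \<in> {0..1}" "\<mu> * t + \<nu> * t' \<in> {0..1}"
      using convexD[OF convex_real_interval(5)[of 0 1] _ _ \<mu>\<nu>] st by auto
    ultimately show "\<mu> *\<^sub>R x + \<nu> *\<^sub>R y \<in> ?P"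
      using \<mu>\<nu>(3) by auto
  qed
  ultimately show "convex hull ?S \<subseteq> ?P" by (rule hull_minimal)
  show "?P \<subseteq> convex hull ?S"
  proof
    fix x assume "x \<in> ?P"
    then obtain s t where x: "x = a + s *\<^sub>R v + t *\<^sub>R w" and st: "0 \<le> t" "t \<le> 1" "0 \<le> s" "s \<le> 1" by blast
    let ?H = "convex hull ?S"
    have "(1 - s) *\<^sub>R a + s *\<^sub>R (a + v) \<in> ?H" "(1 - s) *\<^sub>R (a + w) + s *\<^sub>R (a + v + w) \<in> ?H"
      by (rule convexD[OF convex_convex_hull]; simp add: hull_inc st)+
    then have "(1 - t) *\<^sub>R ((1 - s) *\<^sub>R a + s *\<^sub>R (a + v)) + t *\<^sub>R ((1 - s) *\<^sub>R (a + w) + s *\<^sub>R (a + v + w)) \<in> ?H"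
      by (intro convexD[OF convex_convex_hull]) (use st in \<open>auto simp del: insert_iff intro: hull_inc\<close>)
    moreover have "(1 - t) *\<^sub>R ((1 - s) *\<^sub>R a + s *\<^sub>R (a + v)) + t *\<^sub>R ((1 - s) *\<^sub>R (a + w) + s *\<^sub>R (a + v + w)) = x"
      by (simp add: x algebra_simps)
    ultimately show "x \<in> ?H" by simp
  qed
qed

lemma divergence_parallelogram:
  assumes J: "0 < cross2 v w"
  shows "divergence_formula (convex hull {a, a + v, a + w, a + v + w})
    {(a, a + v), (a + v, a + v + w), (a + v + w, a + w), (a + w, a)} d"
proof (rule divergence_formula_spanned)
  let ?K = "convex hull {a, a + v, a + w, a + v + w}"
  let ?E = "{(a, a + v), (a + v, a + v + w), (a + v + w, a + w), (a + w, a)}"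
  have wv: "cross2 w v = - cross2 v w" by (rule cross2_commute)
  have nz: "v \<noteq> 0" "w \<noteq> 0" "v \<noteq> w" "v + w \<noteq> 0"
    using J by (auto simp: cross2_def add_eq_0_iff)
  have K: "?K = {a + s *\<^sub>R v + t *\<^sub>R w | s t. 0 \<le> t \<and> t \<le> 1 \<and> 0 \<le> s \<and> s \<le> 1 - 0 * t}"
    "?K = {a + s *\<^sub>R w + t *\<^sub>R v | s t. 0 \<le> t \<and> t \<le> 1 \<and> 0 \<le> s \<and> s \<le> 1 - 0 * t}"
    using convex_hull_parallelogram[of a v w] convex_hull_parallelogram[of a w v]
    by (simp_all add: insert_commute add_ac)
  have lp: "a + (1 - 0 * t) *\<^sub>R v + t *\<^sub>R w = linepath (a + v) (a + v + w) t"
    "a + t *\<^sub>R w = linepath a (a + w) t"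
    "a + (1 - 0 * t) *\<^sub>R w + t *\<^sub>R v = linepath (a + w) (a + v + w) t"
    "a + t *\<^sub>R v = linepath a (a + v) t" for t
    by (simp_all add: linepath_def algebra_simps)
  show "compact ?K" by (simp add: finite_imp_compact_convex_hull)
  show "cross2 v w \<noteq> 0" using J by simp
  have sym: "segment_mean f q p = segment_mean f p q" if "has_cont_grad f g" for f g p q
    using that by (intro segment_mean_commute has_cont_grad_continuous_on)
  have sum: "(\<Sum>(p, q)\<in>?E. cross2 z (q - p) * segment_mean f p q)
    = cross2 z v * (segment_mean f a (a + v) - segment_mean f (a + w) (a + v + w))
    + cross2 z w * (segment_mean f (a + v) (a + v + w) - segment_mean f a (a + w))"
    if "has_cont_grad f g" for f g z
    using nz sym[OF that, of a "a + w"] sym[OF that, of "a + w" "a + v + w"]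
    by (simp add: cross2_simps algebra_simps)
  show "divergence_formula ?K ?E v"
    unfolding divergence_formula_def
  proof (intro allI impI)
    fix f g assume fg: "has_cont_grad f g"
    have "integral ?K (\<lambda>x. g x \<bullet> v)
      = cross2 v w * (segment_mean f (a + v) (a + v + w) - segment_mean f a (a + w))"
      using integral_directional_derivative[OF fg _ _ _ K(1)] J unfolding lp(1,2)
      by (simp add: segment_mean_def cross2_def)
    then show "integral ?K (\<lambda>x. g x \<bullet> v) = (\<Sum>(p, q)\<in>?E. cross2 v (q - p) * segment_mean f p q)"
      by (simp only: sum[OF fg] cross2_triv mult_zero_left add_0_left)
  qed
  show "divergence_formula ?K ?E w"
    unfolding divergence_formula_def
  proof (intro allI impI)
    fix f g assume fg: "has_cont_grad f g"
    have "integral ?K (\<lambda>x. g x \<bullet> w)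
      = cross2 v w * (segment_mean f (a + w) (a + v + w) - segment_mean f a (a + v))"
      using integral_directional_derivative[OF fg _ _ _ K(2)] J unfolding lp(3,4)
      by (simp add: segment_mean_def cross2_def mult.commute)
    then show "integral ?K (\<lambda>x. g x \<bullet> w) = (\<Sum>(p, q)\<in>?E. cross2 w (q - p) * segment_mean f p q)"
      by (simp only: sum[OF fg] cross2_triv wv) (simp add: algebra_simps)
  qed
qed

text \<open>Exchanging two vertices of a triangle, or the two side vectors of a rectangle, reverses the
  orientation, so the counterclockwise case is the general one.\<close>

lemma element_boundary:
  assumes "element K"
  obtains E where "oriented_boundary K E" "\<And>d. divergence_formula K E d"
  using assms
proof
  assume "triangle K"
  then obtain a b c where nc: "\<not> collinear {a, b, c}" and K: "K = convex hull {a, b, c}"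
    by (auto simp: triangle_def)
  show thesis
  proof (cases "0 < cross2 (b - a) (c - a)")
    case True
    then show thesis using oriented_boundary_triangle divergence_triangle K that by blast
  next
    case False
    then have "0 < cross2 (c - a) (b - a)"
      using nc cross2_commute[of "c - a" "b - a"] by (auto simp: collinear_iff_cross2)
    moreover have "K = convex hull {a, c, b}" by (simp add: K insert_commute)
    ultimately show thesis using oriented_boundary_triangle divergence_triangle that by blast
  qed
next
  assume "rectangle K"
  then obtain a v w where vw: "v \<noteq> 0" "w \<noteq> 0" "v \<bullet> w = 0"
    and K: "K = convex hull {a, a + v, a + w, a + v + w}"
    by (auto simp: rectangle_def)
  have "cross2 v w \<noteq> 0" using vw by (rule cross2_orthogonal_nonzero)
  then consider "0 < cross2 v w" | "0 < cross2 w v"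
    using cross2_commute[of v w] by linarith
  then show thesis
  proof cases
    case 1
    then show thesis using oriented_boundary_parallelogram divergence_parallelogram K that by blast
  next
    case 2
    have "K = convex hull {a, a + w, a + v, a + w + v}" by (simp add: K insert_commute add_ac)
    then show thesis using 2 oriented_boundary_parallelogram divergence_parallelogram that by blast
  qed
qed

lemma element_convex_body:
  assumes "element K"
  shows "compact K" "convex K" "interior K \<noteq> {}"
proof -
  have tri: "interior (convex hull {a, b, c}) \<noteq> {}" if "\<not> collinear {a, b, c}" for a b c :: "real^2"
  proof -
    have "card {a, b, c} = Suc (DIM(real^2))"
      using that by (auto simp: card_insert_if insert_commute)
    then show ?thesis
      using that interior_convex_hull_eq_empty[of "{a, b, c}"]
      by (simp add: collinear_3_eq_affine_dependent)
  qed
  show "compact K" "convex K"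
    using assms by (auto simp: triangle_def rectangle_def finite_imp_compact_convex_hull)
  show "interior K \<noteq> {}"
    using assms
  proof
    assume "triangle K"
    then show ?thesis using tri by (auto simp: triangle_def)
  next
    assume "rectangle K"
    then obtain a v w where vw: "v \<noteq> 0" "w \<noteq> 0" "v \<bullet> w = 0"
      and K: "K = convex hull {a, a + v, a + w, a + v + w}"
      by (auto simp: rectangle_def)
    have "cross2 v w \<noteq> 0" using vw by (rule cross2_orthogonal_nonzero)
    then have "interior (convex hull {a, a + v, a + w}) \<noteq> {}"
      by (intro tri) (simp add: collinear_iff_cross2)
    moreover have "interior (convex hull {a, a + v, a + w}) \<subseteq> interior K"
      unfolding K by (intro interior_mono hull_mono) auto
    ultimately show ?thesis by blast
  qed
qed

section \<open>Outward normals\<close>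

text \<open>The defining property of the outward normal, detached from the definite description that selects it.\<close>

definition is_outward_normal :: "(real^2) set \<Rightarrow> (real^2) set \<Rightarrow> real^2 \<Rightarrow> bool" where
  "is_outward_normal K e n \<longleftrightarrow> norm n = 1 \<and>
     (\<forall>x\<in>e. \<forall>y\<in>e. n \<bullet> (y - x) = 0) \<and> (\<forall>x\<in>e. \<forall>y\<in>K. n \<bullet> (y - x) \<le> 0)"

lemma is_outward_normal_interior:
  assumes n: "is_outward_normal K e n" and x: "x \<in> e" and a: "a \<in> interior K"
  shows "n \<bullet> (a - x) < 0"
proof -
  have n0: "n \<noteq> 0"
    using n by (auto simp: is_outward_normal_def)
  have "n \<bullet> y \<le> n \<bullet> x" if "y \<in> K" for y
  proof -
    have "n \<bullet> (y - x) \<le> 0"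
      using n x that unfolding is_outward_normal_def by blast
    then show ?thesis by (simp add: inner_diff_right)
  qed
  then have K: "K \<subseteq> {y. n \<bullet> y \<le> n \<bullet> x}" by blast
  have "interior K \<subseteq> {y. n \<bullet> y < n \<bullet> x}"
    using interior_mono[OF K] unfolding interior_halfspace_le[OF n0] .
  then have "n \<bullet> a < n \<bullet> x" using a by blast
  then show ?thesis by (simp add: inner_diff_right)
qed

text \<open>In the plane the vectors orthogonal to \<open>q - p\<close> form a line.\<close>

lemma unit_normals_of_segment:
  fixes p q n n' :: "real^2"
  assumes "p \<noteq> q" "norm n = 1" "norm n' = 1" "n \<bullet> (q - p) = 0" "n' \<bullet> (q - p) = 0"
  shows "n' = n \<or> n' = - n"
proof -
  define z :: "real^2" where "z = pt ((q - p)$2) (- (q - p)$1)"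
  have z: "z \<noteq> 0" using assms(1) by (auto simp: z_def vec_eq_iff forall_2)
  have "cross2 n z = 0" "cross2 n' z = 0"
    using assms(4,5) by (auto simp: cross2_def z_def inner_vec_def sum_2 algebra_simps)
  then obtain \<alpha> \<alpha>' where \<alpha>: "n = \<alpha> *\<^sub>R z" "n' = \<alpha>' *\<^sub>R z"
    using cross2_eq_0_imp_scaled z by blast
  then have "\<bar>\<alpha>\<bar> * norm z = \<bar>\<alpha>'\<bar> * norm z" using assms(2,3) by simp
  then have "\<bar>\<alpha>\<bar> = \<bar>\<alpha>'\<bar>" using z by simp
  then show ?thesis using \<alpha> by (auto simp: abs_eq_iff)
qed

lemma is_outward_normal_unique_up_to_sign:
  assumes pq: "p \<noteq> q" and "is_outward_normal K (closed_segment p q) n"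
    "is_outward_normal K' (closed_segment p q) n'"
  shows "n' = n \<or> n' = - n"
  using assms(2,3) by (intro unit_normals_of_segment[OF pq]) (simp_all add: is_outward_normal_def)

lemma outward_normal_eq:
  assumes pq: "p \<noteq> q" and n: "is_outward_normal K (closed_segment p q) n" and K: "interior K \<noteq> {}"
  shows "outward_normal K (closed_segment p q) = n"
  unfolding outward_normal_def is_outward_normal_def[symmetric]
proof (rule the_equality, rule n)
  fix n' assume n': "is_outward_normal K (closed_segment p q) n'"
  obtain a where a: "a \<in> interior K" using K by blast
  have "n' \<noteq> - n"
    using is_outward_normal_interior[OF n _ a, of p] is_outward_normal_interior[OF n' _ a, of p] by auto
  then show "n' = n"
    using is_outward_normal_unique_up_to_sign[OF pq n n'] by blast
qed

lemma oriented_edge_normal: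
  assumes E: "oriented_boundary K E" "(p, q) \<in> E" and K: "interior K \<noteq> {}"
  shows "is_outward_normal K (closed_segment p q) (outward_normal K (closed_segment p q))"
    and "norm (q - p) * (outward_normal K (closed_segment p q) \<bullet> d) = cross2 d (q - p)"
proof -
  have pq: "p \<noteq> q" and left: "\<And>y. y \<in> K \<Longrightarrow> 0 \<le> cross2 (q - p) (y - p)"
    using E by (auto simp: oriented_boundary_def)
  define n where "n = (1 / norm (q - p)) *\<^sub>R pt ((q - p)$2) (- (q - p)$1)"
  have nd: "n \<bullet> d = cross2 d (q - p) / norm (q - p)" for d
    unfolding cross2_eq_inner by (simp add: n_def)
  have rot: "norm (pt (z$2) (- z$1)) = norm z" for z :: "real^2"
    by (simp add: norm_vec_def L2_set_def sum_2 add.commute)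
  have n1: "norm n = 1"
    using pq rot[of "q - p"] by (simp add: n_def)
  have shift: "n \<bullet> (y - x) = - cross2 (q - p) (y - p) / norm (q - p)" if "x \<in> closed_segment p q" for x y
  proof -
    have "cross2 (q - p) (x - p) = 0" by (rule cross2_closed_segment) fact
    then have "cross2 (y - x) (q - p) = - cross2 (q - p) (y - p)"
      by (simp add: cross2_def algebra_simps)
    then show ?thesis by (simp add: nd)
  qed
  have n: "is_outward_normal K (closed_segment p q) n"
    unfolding is_outward_normal_def
    using n1 left pq by (auto simp: shift cross2_closed_segment)
  have "outward_normal K (closed_segment p q) = n"
    by (rule outward_normal_eq[OF pq n K])
  then show "is_outward_normal K (closed_segment p q) (outward_normal K (closed_segment p q))"
    "norm (q - p) * (outward_normal K (closed_segment p q) \<bullet> d) = cross2 d (q - p)"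
    using n nd[of d] pq by simp_all
qed

text \<open>The two normals are equal or opposite. If they were equal, both sets would lie on the same side of
  the common edge. Starting from the midpoint \<open>c\<close> of the edge and moving a little towards an interior
  point \<open>a\<close> of \<open>K\<close> stays in the interior of \<open>K\<close>. The same point is reached from another point of the
  edge by moving towards an interior point \<open>a'\<close> of \<open>K'\<close>, so it is interior to \<open>K'\<close> as well.\<close>

lemma opposite_outward_normals:
  assumes conv: "convex K" "convex K'" and e: "closed_segment p q \<subseteq> K" "closed_segment p q \<subseteq> K'"
    and pq: "p \<noteq> q" and n: "is_outward_normal K (closed_segment p q) n"
    and n': "is_outward_normal K' (closed_segment p q) n'"
    and int: "interior K \<noteq> {}" "interior K' \<noteq> {}" "interior K \<inter> interior K' = {}"
  shows "n' = - n"
proof (rule ccontr)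
  assume "n' \<noteq> - n"
  then have n': "is_outward_normal K' (closed_segment p q) n"
    using is_outward_normal_unique_up_to_sign[OF pq n n'] n' by blast
  obtain a a' where a: "a \<in> interior K" and a': "a' \<in> interior K'" using int by blast
  define c where "c = midpoint p q"
  have c: "c \<in> closed_segment p q" by (simp add: c_def)
  have neg: "n \<bullet> (a - c) < 0" "n \<bullet> (a' - c) < 0"
    using is_outward_normal_interior[OF n c a] is_outward_normal_interior[OF n' c a'] by auto
  \<comment> \<open>The factor \<open>\<alpha>\<close> matches the distances of \<open>a\<close> and \<open>a'\<close> from the line of the edge, so that
    \<open>a - c\<close> and \<open>\<alpha> *\<^sub>R (a' - c)\<close> differ by a multiple \<open>\<beta>\<close> of the edge vector.\<close>
  define \<alpha> where "\<alpha> = (n \<bullet> (a - c)) / (n \<bullet> (a' - c))"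
  have \<alpha>: "\<alpha> > 0" using neg by (simp add: \<alpha>_def divide_neg_neg)
  have "n \<bullet> (q - p) = 0" using n by (simp add: is_outward_normal_def)
  moreover have "n \<bullet> ((a - c) - \<alpha> *\<^sub>R (a' - c)) = 0"
    using neg by (simp add: \<alpha>_def inner_diff_right)
  moreover have "n \<noteq> 0" using n by (auto simp: is_outward_normal_def)
  ultimately have "cross2 ((a - c) - \<alpha> *\<^sub>R (a' - c)) (q - p) = 0"
  proof -
    assume h: "n \<bullet> (q - p) = 0" "n \<bullet> ((a - c) - \<alpha> *\<^sub>R (a' - c)) = 0" "n \<noteq> 0"
    have *: "n $ 1 * cross2 x y = (n \<bullet> x) * y$2 - (n \<bullet> y) * x$2"
      "n $ 2 * cross2 x y = (n \<bullet> y) * x$1 - (n \<bullet> x) * y$1" for x y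
      by (simp_all add: cross2_def inner_vec_def sum_2 algebra_simps)
    have "n $ 1 \<noteq> 0 \<or> n $ 2 \<noteq> 0" using h(3) by (auto simp: vec_eq_iff forall_2)
    then show ?thesis
      using *[of "(a - c) - \<alpha> *\<^sub>R (a' - c)" "q - p"] h(1,2) by auto
  qed
  then obtain \<beta> where \<beta>: "(a - c) - \<alpha> *\<^sub>R (a' - c) = \<beta> *\<^sub>R (q - p)"
    using cross2_eq_0_imp_scaled pq by (metis eq_iff_diff_eq_0)
  \<comment> \<open>small enough for the point \<open>y\<close> below, displaced along the edge, to remain on the edge\<close>
  define \<epsilon> where "\<epsilon> = 1 / (1 + \<alpha> + 2 * \<bar>\<beta>\<bar>)"
  have \<epsilon>: "0 < \<epsilon>" "\<epsilon> \<le> 1" "\<epsilon> * \<alpha> + 2 * (\<epsilon> * \<bar>\<beta>\<bar>) < 1"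
  proof -
    have s: "0 < 1 + \<alpha> + 2 * \<bar>\<beta>\<bar>" using \<alpha> by simp
    then show "0 < \<epsilon>" "\<epsilon> \<le> 1" using \<alpha> by (simp_all add: \<epsilon>_def)
    have "\<epsilon> * (1 + \<alpha> + 2 * \<bar>\<beta>\<bar>) = 1" using s by (simp add: \<epsilon>_def)
    then show "\<epsilon> * \<alpha> + 2 * (\<epsilon> * \<bar>\<beta>\<bar>) < 1"
      using \<open>0 < \<epsilon>\<close> by (simp add: algebra_simps)
  qed
  have "0 \<le> \<epsilon> * \<bar>\<beta>\<bar>" using \<epsilon>(1) by simp
  then have \<epsilon>\<alpha>: "0 < \<epsilon> * \<alpha>" "\<epsilon> * \<alpha> < 1"
    using \<epsilon> \<alpha> by (simp, linarith)
  define z where "z = c - \<epsilon> *\<^sub>R (c - a)"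
  have "z \<in> interior K"
    unfolding z_def using c e(1) closure_subset \<epsilon>
    by (intro mem_interior_closure_convex_shrink[OF conv(1) a]) auto
  moreover have "z \<in> interior K'"
  proof -
    define \<mu> where "\<mu> = \<epsilon> * \<beta> / (1 - \<epsilon> * \<alpha>)"
    define y where "y = c + \<mu> *\<^sub>R (q - p)"
    have "2 * \<bar>\<epsilon> * \<beta>\<bar> < 1 - \<epsilon> * \<alpha>" using \<epsilon> by (simp add: abs_mult)
    then have "\<bar>\<mu>\<bar> \<le> 1/2"
      using \<epsilon>\<alpha> by (simp add: \<mu>_def abs_divide divide_le_eq)
    then have "0 \<le> 1/2 + \<mu>" "1/2 + \<mu> \<le> 1" by auto
    moreover have "y = (1 - (1/2 + \<mu>)) *\<^sub>R p + (1/2 + \<mu>) *\<^sub>R q"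
      by (simp add: y_def c_def midpoint_def algebra_simps)
    ultimately have y: "y \<in> closed_segment p q"
      unfolding closed_segment_def by blast
    have "(1 - \<epsilon> * \<alpha>) *\<^sub>R y = (1 - \<epsilon> * \<alpha>) *\<^sub>R c + (\<epsilon> * \<beta>) *\<^sub>R (q - p)"
      using \<epsilon>\<alpha> by (simp add: y_def \<mu>_def scaleR_add_right)
    also have "(\<epsilon> * \<beta>) *\<^sub>R (q - p) = \<epsilon> *\<^sub>R ((a - c) - \<alpha> *\<^sub>R (a' - c))"
      by (simp add: \<beta>)
    finally have "z = y - (\<epsilon> * \<alpha>) *\<^sub>R (y - a')"
      by (simp add: z_def algebra_simps)
    moreover have "y - (\<epsilon> * \<alpha>) *\<^sub>R (y - a') \<in> interior K'"
      using y e(2) closure_subset \<epsilon>\<alpha> by (intro mem_interior_closure_convex_shrink[OF conv(2) a']) auto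
    ultimately show ?thesis by simp
  qed
  ultimately show False using int(3) by blast
qed

section \<open>Integrals over elements, traces and edge integrals\<close>

text \<open>Functions of the discrete space are only determined inside the elements; the boundary of an element
  is negligible, so integrals may be computed with the polynomial instead.\<close>

lemma set_integral_interior_cong:
  fixes f h :: "real^2 \<Rightarrow> real"
  assumes K: "compact K" "convex K" and h: "continuous_on K h"
    and fh: "\<And>x. x \<in> interior K \<Longrightarrow> f x = h x"
  shows "(LINT x:K|lebesgue. f x) = integral K h"
proof -
  have N: "negligible (frontier K)"
    by (rule negligible_convex_frontier[OF K(2)])
  have eq: "f x = h x" if "x \<in> K - frontier K" for x
    using that fh K(1) by (simp add: frontier_def compact_imp_closed closure_closed)
  have "f absolutely_integrable_on K"
    by (rule absolutely_integrable_spike[OF absolutely_integrable_continuous_compact[OF K(1) h] N eq])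
  then have "(LINT x:K|lebesgue. f x) = integral K f"
    by (rule set_lebesgue_integral_eq_integral(2))
  also have "\<dots> = integral K h"
    by (rule integral_spike[OF N]) (simp add: eq)
  finally show ?thesis .
qed

lemma integrable_continuous_compact:
  fixes h :: "real^2 \<Rightarrow> real"
  shows "compact K \<Longrightarrow> continuous_on K h \<Longrightarrow> h integrable_on K"
  using absolutely_integrable_continuous_compact set_lebesgue_integral_eq_integral(1) by blast

text \<open>A convex body is the closure of its interior, so the limit from inside exists and is the value of the
  continuous extension.\<close>

lemma trace_in_eq:
  fixes \<phi> P :: "real^2 \<Rightarrow> 'a::t2_space"
  assumes K: "convex K" "interior K \<noteq> {}" "closed K" and x: "x \<in> K"
    and P: "continuous_on UNIV P" "\<And>y. y \<in> interior K \<Longrightarrow> \<phi> y = P y"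
  shows "trace_in K \<phi> x = P x"
proof -
  have "x \<in> closure (interior K)"
    using K x by (simp add: convex_closure_interior closure_closed)
  then have "x islimpt interior K"
    using interior_limit_point[of x "interior K"] by (auto simp: closure_def)
  then have nt: "\<not> trivial_limit (at x within interior K)"
    by (simp add: trivial_limit_within)
  have "(P \<longlongrightarrow> P x) (at x within interior K)"
    using P(1) by (metis UNIV_I continuous_on_def tendsto_within_subset subset_UNIV)
  then have "(\<phi> \<longlongrightarrow> P x) (at x within interior K)"
    by (rule Lim_transform_eventually) (simp add: eventually_at_filter P(2))
  then show ?thesis
    unfolding trace_in_def by (rule tendsto_Lim[OF nt])
qed

lemma edge_integral_cong:
  assumes "e = closed_segment p q" "\<And>x. x \<in> e \<Longrightarrow> f x = g x"
  shows "edge_integral e f = edge_integral e g"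
proof -
  have "(LINT s:{0..1}|lebesgue. f (linepath p q s)) = (LINT s:{0..1}|lebesgue. g (linepath p q s))"
    unfolding set_lebesgue_integral_def
    by (intro Bochner_Integration.integral_cong refl)
       (use assms linepath_in_path in \<open>auto simp: indicator_def\<close>)
  then show ?thesis
    unfolding assms(1) edge_integral_segment by simp
qed

lemma edge_integral_nonneg:
  assumes "e = closed_segment p q" "\<And>x. x \<in> e \<Longrightarrow> 0 \<le> f x"
  shows "0 \<le> edge_integral e f"
proof -
  have "0 \<le> (LINT s:{0..1}|lebesgue. f (linepath p q s))"
    unfolding set_lebesgue_integral_def
    by (intro Bochner_Integration.integral_nonneg)
       (use assms linepath_in_path in \<open>auto simp: indicator_def\<close>)
  then show ?thesis
    unfolding assms(1) edge_integral_segment by simp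
qed

lemma edge_integral_add:
  assumes e: "e = closed_segment p q" and "continuous_on e f" "continuous_on e g"
  shows "edge_integral e (\<lambda>x. f x + g x) = edge_integral e f + edge_integral e g"
proof -
  have "(\<lambda>s. h (linepath p q s)) absolutely_integrable_on {0..1}" if "continuous_on e h" for h :: "real^2 \<Rightarrow> real"
  proof (rule absolutely_integrable_continuous_real)
    show "continuous_on {0..1} (\<lambda>s. h (linepath p q s))"
      using that unfolding e
      by (rule continuous_on_compose2) (auto simp: linepath_in_path continuous_on_linepath)
  qed
  then have "(LINT s:{0..1}|lebesgue. f (linepath p q s) + g (linepath p q s))
      = (LINT s:{0..1}|lebesgue. f (linepath p q s)) + (LINT s:{0..1}|lebesgue. g (linepath p q s))"
    using assms by (intro set_integral_add(2)) auto
  then show ?thesis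
    unfolding e edge_integral_segment by (simp add: distrib_left)
qed

lemma edge_integral_cmult:
  assumes e: "e = closed_segment p q"
  shows "edge_integral e (\<lambda>x. c * f x) = c * edge_integral e f"
  unfolding e edge_integral_segment by simp

lemma edge_integral_sum:
  assumes e: "e = closed_segment p q" and "finite I" "\<And>i. i \<in> I \<Longrightarrow> continuous_on e (f i)"
  shows "edge_integral e (\<lambda>x. \<Sum>i\<in>I. f i x) = (\<Sum>i\<in>I. edge_integral e (f i))"
  using assms(2,3)
proof (induction I)
  case empty
  then show ?case using edge_integral_cmult[OF e, of 0 "\<lambda>x. 0"] by simp
next
  case (insert i I)
  then show ?case
    by (simp add: edge_integral_add[OF e] continuous_on_sum)
qed

section \<open>Differentiating the charge of one element in time\<close>

text \<open>The Lagrange basis polynomial of the node \<open>a i\<close> among the \<open>q + 1\<close> nodes \<open>a 0, \<dots>, a q\<close>.\<close>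

definition lagrange :: "nat \<Rightarrow> (nat \<Rightarrow> real) \<Rightarrow> nat \<Rightarrow> real \<Rightarrow> real" where
  "lagrange q a i x = (\<Prod>j\<in>{..q} - {i}. (x - a j) / (a i - a j))"

text \<open>Both sides are polynomials of degree at most \<open>q\<close> in \<open>x\<close> that agree at the \<open>q + 1\<close> nodes.\<close>

lemma lagrange_power:
  assumes "inj_on a {..q}" "k \<le> q"
  shows "x ^ k = (\<Sum>i\<le>q. (a i) ^ k * lagrange q a i x)"
proof -
  define L where "L i = (\<Prod>j\<in>{..q} - {i}. smult (1 / (a i - a j)) [:- a j, 1:])" for i
  have L: "poly (L i) y = lagrange q a i y" for i y
    by (simp add: L_def lagrange_def poly_prod diff_divide_distrib)
  have dL: "degree (L i) \<le> q" if "i \<le> q" for i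
  proof -
    have "degree (L i) \<le> (\<Sum>j\<in>{..q} - {i}. degree (smult (1 / (a i - a j)) [:- a j, 1:]))"
      unfolding L_def by (rule degree_prod_sum_le[unfolded o_def]) simp
    also have "\<dots> \<le> (\<Sum>j\<in>{..q} - {i}. 1)"
      by (rule sum_mono) simp
    also have "\<dots> = q" using that by simp
    finally show ?thesis .
  qed
  have node: "lagrange q a i (a l) = (if i = l then 1 else 0)" if "i \<le> q" "l \<le> q" for i l
  proof (cases "i = l")
    case True
    have "lagrange q a i (a l) = (\<Prod>j\<in>{..q} - {i}. 1)"
      unfolding lagrange_def
      by (rule prod.cong) (use True that assms(1) in \<open>auto simp: inj_on_def\<close>)
    then show ?thesis using True by simp
  next
    case False
    then show ?thesis
      using that by (auto simp: lagrange_def intro!: prod_zero)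
  qed
  have "monom 1 k = (\<Sum>i\<le>q. smult (a i ^ k) (L i))"
  proof (rule poly_eqI_degree[where A = "a ` {..q}"])
    fix y assume "y \<in> a ` {..q}"
    then obtain l where l: "l \<le> q" "y = a l" by auto
    have "(\<Sum>i\<le>q. a i ^ k * lagrange q a i y) = (\<Sum>i\<le>q. if i = l then a l ^ k else 0)"
      by (rule sum.cong) (use l node in auto)
    then show "poly (monom 1 k) y = poly (\<Sum>i\<le>q. smult (a i ^ k) (L i)) y"
      using l by (simp add: poly_sum L poly_monom)
  next
    have card: "card (a ` {..q}) = Suc q" using assms(1) by (simp add: card_image)
    show "degree (monom 1 k :: real poly) < card (a ` {..q})"
      using assms(2) by (simp add: card degree_monom_eq)
    have "degree (\<Sum>i\<le>q. smult (a i ^ k) (L i)) \<le> q"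
      by (rule degree_sum_le) (use dL degree_smult_le order_trans in auto)
    then show "degree (\<Sum>i\<le>q. smult (a i ^ k) (L i)) < card (a ` {..q})"
      by (simp add: card)
  qed
  then have "poly (monom 1 k) x = poly (\<Sum>i\<le>q. smult (a i ^ k) (L i)) x" by simp
  then show ?thesis by (simp add: poly_sum L poly_monom)
qed

text \<open>Total degree at most \<open>q\<close> implies degree at most \<open>q\<close> in each variable, so interpolation on a tensor
  grid reproduces \<open>p\<close>.\<close>

lemma poly_space_interpolation:
  assumes p: "p \<in> poly_space q" and a: "inj_on a {..q}" "inj_on b {..q}"
  shows "p x = (\<Sum>(i, j)\<in>{..q} \<times> {..q}. p (pt (a i) (b j)) * (lagrange q a i (x$1) * lagrange q b j (x$2)))"
proof -
  obtain c where c: "\<And>x. p x = (\<Sum>k\<le>q. \<Sum>l\<le>q - k. c k l * (x$1) ^ k * (x$2) ^ l)"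
    using p by (auto simp: poly_space_def)
  let ?A = "\<lambda>i. lagrange q a i (x$1)" and ?B = "\<lambda>j. lagrange q b j (x$2)"
  have "p x = (\<Sum>k\<le>q. \<Sum>l\<le>q - k. c k l * (\<Sum>i\<le>q. (a i) ^ k * ?A i) * (\<Sum>j\<le>q. (b j) ^ l * ?B j))"
    unfolding c by (intro sum.cong refl) (simp flip: lagrange_power[OF a(1)] lagrange_power[OF a(2)])
  also have "\<dots> = (\<Sum>k\<le>q. \<Sum>l\<le>q - k. \<Sum>z\<in>{..q} \<times> {..q}.
      c k l * (a (fst z)) ^ k * (b (snd z)) ^ l * (?A (fst z) * ?B (snd z)))"
    by (intro sum.cong refl)
       (simp add: sum_product sum.cartesian_product case_prod_unfold sum_distrib_left mult_ac)
  also have "\<dots> = (\<Sum>k\<le>q. \<Sum>z\<in>{..q} \<times> {..q}. \<Sum>l\<le>q - k.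
      c k l * (a (fst z)) ^ k * (b (snd z)) ^ l * (?A (fst z) * ?B (snd z)))"
    by (intro sum.cong refl sum.swap)
  also have "\<dots> = (\<Sum>z\<in>{..q} \<times> {..q}. \<Sum>k\<le>q. \<Sum>l\<le>q - k.
      c k l * (a (fst z)) ^ k * (b (snd z)) ^ l * (?A (fst z) * ?B (snd z)))"
    by (rule sum.swap)
  also have "\<dots> = (\<Sum>(i, j)\<in>{..q} \<times> {..q}. p (pt (a i) (b j)) * (?A i * ?B j))"
    by (simp add: c sum_distrib_right case_prod_unfold)
  finally show ?thesis .
qed

lemma continuous_on_lagrange: "continuous_on S f \<Longrightarrow> continuous_on S (\<lambda>x. lagrange q a i (f x))"
  unfolding lagrange_def divide_inverse by (intro continuous_intros)

lemma grid_in_open: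
  assumes "open S" "S \<noteq> {}"
  obtains a b :: "nat \<Rightarrow> real" where "inj_on a {..q}" "inj_on b {..q}"
    "\<And>i j. i \<le> q \<Longrightarrow> j \<le> q \<Longrightarrow> pt (a i) (b j) \<in> S"
proof -
  obtain x e where e: "e > 0" "ball x e \<subseteq> S"
    using assms open_contains_ball by blast
  \<comment> \<open>All offsets from \<open>x\<close> are at most \<open>q * h < e / 2\<close>.\<close>
  define h where "h = e / (2 * (real q + 1))"
  have h: "h > 0" using e by (simp add: h_def)
  have small: "real i * h < e / 2" if "i \<le> q" for i
  proof -
    have "real i * h < (real q + 1) * h" using that h by simp
    also have "\<dots> = e / 2" by (simp add: h_def field_simps)
    finally show ?thesis .
  qed
  show thesis
  proof
    show "inj_on (\<lambda>i. x$1 + real i * h) {..q}" "inj_on (\<lambda>i. x$2 + real i * h) {..q}"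
      using h by (auto simp: inj_on_def)
    fix i j assume ij: "i \<le> q" "j \<le> q"
    let ?y = "pt (x$1 + real i * h) (x$2 + real j * h)"
    have "dist x ?y \<le> (\<Sum>k\<in>UNIV. \<bar>(?y - x) $ k\<bar>)"
      unfolding dist_norm norm_minus_commute[of x] by (rule norm_le_l1_cart)
    also have "\<dots> < e" using small[OF ij(1)] small[OF ij(2)] h by (simp add: sum_2)
    finally show "?y \<in> S" using e by (auto simp: mem_ball)
  qed
qed

lemma nontrivial_at_within_nonneg:
  assumes "0 \<le> (t::real)"
  shows "at t within {0..} \<noteq> bot"
proof -
  have "t islimpt {t<..<t + 1}"
    by (rule islimpt_greaterThanLessThan1) simp
  then have "t islimpt {0..}"
    by (rule islimpt_subset) (use assms in auto)
  then show ?thesis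
    by (simp add: trivial_limit_within)
qed

text \<open>Interpolation at a grid inside \<open>K\<close> writes \<open>\<phi> s\<close> as a combination of fixed functions \<open>\<Phi> z\<close> with the
  coefficients \<open>\<phi> s (y z)\<close>, which are differentiable in \<open>s\<close> by assumption. The integral of the square is
  then a quadratic form in the coefficients whose matrix \<open>G\<close> does not depend on time, and the product
  rule applies.\<close>

lemma square_integral_has_derivative:
  fixes \<phi> \<phi>' :: "real \<Rightarrow> real^2 \<Rightarrow> real"
  assumes K: "element K"
    and poly: "\<And>t. t \<ge> 0 \<Longrightarrow> \<exists>p\<in>poly_space q. \<forall>x\<in>interior K. \<phi> t x = p x"
    and der: "\<And>t x. t \<ge> 0 \<Longrightarrow> x \<in> interior K \<Longrightarrow>
      ((\<lambda>s. \<phi> s x) has_real_derivative \<phi>' t x) (at t within {0..})"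
    and t: "t \<ge> 0"
  shows "((\<lambda>s. LINT x:K|lebesgue. (\<phi> s x)\<^sup>2) has_real_derivative
      2 * (LINT x:K|lebesgue. \<phi>' t x * \<phi> t x)) (at t within {0..})"
proof -
  note body = element_convex_body[OF K]
  obtain a b :: "nat \<Rightarrow> real" where ab: "inj_on a {..q}" "inj_on b {..q}"
    "\<And>i j. i \<le> q \<Longrightarrow> j \<le> q \<Longrightarrow> pt (a i) (b j) \<in> interior K"
    using grid_in_open[OF open_interior body(3)] by metis
  define I where "I = {..q} \<times> {..q}"
  define y where "y z = pt (a (fst z)) (b (snd z))" for z
  define \<Phi> where "\<Phi> z x = lagrange q a (fst z) (x$1) * lagrange q b (snd z) (x$2)" for z and x :: "real^2"
  have y: "y z \<in> interior K" if "z \<in> I" for z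
    using that ab(3) by (auto simp: I_def y_def)
  have exp: "\<phi> s x = (\<Sum>z\<in>I. \<phi> s (y z) * \<Phi> z x)" if s: "s \<ge> 0" and x: "x \<in> interior K" for s x
  proof -
    obtain p where p: "p \<in> poly_space q" "\<And>x. x \<in> interior K \<Longrightarrow> \<phi> s x = p x"
      using poly[OF s] by blast
    have "p x = (\<Sum>z\<in>I. p (y z) * \<Phi> z x)"
      using poly_space_interpolation[OF p(1) ab(1,2), of x]
      by (simp add: I_def y_def \<Phi>_def case_prod_unfold)
    then show ?thesis using p(2) y x by simp
  qed
  \<comment> \<open>The time derivative inherits the expansion, since derivatives within \<open>{0..}\<close> are unique.\<close>
  have exp': "\<phi>' s x = (\<Sum>z\<in>I. \<phi>' s (y z) * \<Phi> z x)" if "s \<ge> 0" "x \<in> interior K" for s x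
  proof (rule vector_derivative_unique_within[OF nontrivial_at_within_nonneg[OF that(1)]])
    show "((\<lambda>s. \<phi> s x) has_vector_derivative \<phi>' s x) (at s within {0..})"
      using der[OF that] by (simp add: has_real_derivative_iff_has_vector_derivative)
    have "((\<lambda>s. \<Sum>z\<in>I. \<phi> s (y z) * \<Phi> z x) has_real_derivative (\<Sum>z\<in>I. \<phi>' s (y z) * \<Phi> z x)) (at s within {0..})"
      using that(1) y by (intro DERIV_sum DERIV_cmult_right der)
    then have "((\<lambda>s. \<phi> s x) has_real_derivative (\<Sum>z\<in>I. \<phi>' s (y z) * \<Phi> z x)) (at s within {0..})"
      by (rule has_field_derivative_transform_within[OF _ zero_less_one])
         (use that exp in auto)
    then show "((\<lambda>s. \<phi> s x) has_vector_derivative (\<Sum>z\<in>I. \<phi>' s (y z) * \<Phi> z x)) (at s within {0..})"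
      by (simp add: has_real_derivative_iff_has_vector_derivative)
  qed
  have cont: "continuous_on S (\<Phi> z)" for S z
    unfolding \<Phi>_def by (intro continuous_intros continuous_on_lagrange)
  define G where "G z z' = integral K (\<lambda>x. \<Phi> z x * \<Phi> z' x)" for z z'
  have gram: "(LINT x:K|lebesgue. f x) = (\<Sum>z\<in>I. \<Sum>z'\<in>I. c z * d z' * G z z')"
    if "\<And>x. x \<in> interior K \<Longrightarrow> f x = (\<Sum>z\<in>I. c z * \<Phi> z x) * (\<Sum>z\<in>I. d z * \<Phi> z x)" for f c d
  proof -
    have fin: "finite I" by (simp add: I_def)
    have "(LINT x:K|lebesgue. f x) = integral K (\<lambda>x. \<Sum>z\<in>I. \<Sum>z'\<in>I. c z * d z' * (\<Phi> z x * \<Phi> z' x))"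
    proof (rule set_integral_interior_cong[OF body(1,2)])
      show "continuous_on K (\<lambda>x. \<Sum>z\<in>I. \<Sum>z'\<in>I. c z * d z' * (\<Phi> z x * \<Phi> z' x))"
        by (intro continuous_intros cont)
      show "f x = (\<Sum>z\<in>I. \<Sum>z'\<in>I. c z * d z' * (\<Phi> z x * \<Phi> z' x))" if "x \<in> interior K" for x
        using \<open>\<And>x. x \<in> interior K \<Longrightarrow> f x = _\<close>[OF that] by (simp add: sum_product mult_ac)
    qed
    also have "\<dots> = (\<Sum>z\<in>I. \<Sum>z'\<in>I. c z * d z' * G z z')"
      using fin by (simp add: G_def integral_sum integrable_continuous_compact body(1) continuous_intros cont)
    finally show ?thesis .
  qed
  have sq: "(LINT x:K|lebesgue. (\<phi> s x)\<^sup>2) = (\<Sum>z\<in>I. \<Sum>z'\<in>I. \<phi> s (y z) * \<phi> s (y z') * G z z')"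
    if "s \<ge> 0" for s
    using exp[OF that] by (intro gram) (simp add: power2_eq_square)
  have "((\<lambda>s. \<Sum>z\<in>I. \<Sum>z'\<in>I. \<phi> s (y z) * \<phi> s (y z') * G z z') has_real_derivative
      (\<Sum>z\<in>I. \<Sum>z'\<in>I. (\<phi>' t (y z) * \<phi> t (y z') + \<phi>' t (y z') * \<phi> t (y z)) * G z z')) (at t within {0..})"
    using t y by (intro DERIV_sum DERIV_cmult_right DERIV_mult der)
  also have "(\<Sum>z\<in>I. \<Sum>z'\<in>I. (\<phi>' t (y z) * \<phi> t (y z') + \<phi>' t (y z') * \<phi> t (y z)) * G z z')
      = (\<Sum>z\<in>I. \<Sum>z'\<in>I. \<phi>' t (y z) * \<phi> t (y z') * G z z')
      + (\<Sum>z\<in>I. \<Sum>z'\<in>I. \<phi> t (y z) * \<phi>' t (y z') * G z z')"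
    by (simp add: algebra_simps sum.distrib)
  also have "(\<Sum>z\<in>I. \<Sum>z'\<in>I. \<phi>' t (y z) * \<phi> t (y z') * G z z') = (LINT x:K|lebesgue. \<phi>' t x * \<phi> t x)"
    using exp[OF t] exp'[OF t] by (intro gram[symmetric]) simp
  also have "(\<Sum>z\<in>I. \<Sum>z'\<in>I. \<phi> t (y z) * \<phi>' t (y z') * G z z') = (LINT x:K|lebesgue. \<phi>' t x * \<phi> t x)"
    using exp[OF t] exp'[OF t] by (intro gram[symmetric]) simp
  finally have "((\<lambda>s. \<Sum>z\<in>I. \<Sum>z'\<in>I. \<phi> s (y z) * \<phi> s (y z') * G z z') has_real_derivative
      2 * (LINT x:K|lebesgue. \<phi>' t x * \<phi> t x)) (at t within {0..})"
    by simp
  then show ?thesis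
    by (rule has_field_derivative_transform_within[OF _ zero_less_one]) (use t sq in auto)
qed

section \<open>The algebra of the Dirac flux\<close>

lemma flux_nth:
  "flux w $ 1 = vector [w$2, w$4]" "flux w $ 2 = vector [w$1, - w$3]"
  "flux w $ 3 = vector [w$4, - w$2]" "flux w $ 4 = vector [w$3, w$1]"
  by (simp_all add: flux_def alpha_eq beta_eq matrix_vector_mult_def sum_4 vector_4_nth)

lemma flux_inner:
  "(flux w *v n) \<bullet> z = n$1 * (w$2 * z$1 + w$1 * z$2 + w$4 * z$3 + w$3 * z$4)
     + n$2 * (w$4 * z$1 - w$3 * z$2 - w$2 * z$3 + w$1 * z$4)"
  by (simp add: matrix_vector_mult_def inner_vec_def sum_4 sum_2 flux_nth algebra_simps)

text \<open>The matrix \<open>gamma\<close> is antisymmetric; the nonlinearity only enters as a scalar factor.\<close>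

lemma source_inner_self: "source m lam kap w \<bullet> w = 0"
  by (simp add: source_def gamma_eq matrix_vector_mult_def inner_vec_def sum_4 vector_4_nth)

lemma lax_friedrichs_inner:
  "lax_friedrichs n wm wp \<bullet> wm
     = ((flux wm *v n) \<bullet> wm + (flux wp *v n) \<bullet> wm - wp \<bullet> wm + wm \<bullet> wm) / 2"
  by (simp add: lax_friedrichs_def inner_add_left inner_diff_left)

lemma flux_mult: "flux w *v n = n$1 *\<^sub>R (alpha *v w) + n$2 *\<^sub>R (beta *v w)"
  unfolding vec_eq_iff matrix_vector_mul_component[of "flux w"]
  by (simp add: flux_def inner_vec_def sum_2)

lemma continuous_on_matrix_vector_mult [continuous_intros]:
  fixes A :: "real^'n^'m" and S :: "'a::euclidean_space set"
  shows "continuous_on S w \<Longrightarrow> continuous_on S (\<lambda>x. A *v w x)"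
  using linear_continuous_on_compose[OF _ matrix_vector_mul_linear, of S w A] .

lemma continuous_on_lax_friedrichs:
  fixes S :: "'a::euclidean_space set"
  shows "continuous_on S w \<Longrightarrow> continuous_on S z \<Longrightarrow> continuous_on S (\<lambda>x. lax_friedrichs n (w x) (z x))"
  unfolding lax_friedrichs_def flux_mult by (intro continuous_intros)

text \<open>For a noninteger exponent the power is continuous on nonnegative bases, including the base zero
  because the exponent is positive.\<close>

lemma continuous_on_source:
  fixes S :: "'a::euclidean_space set"
  assumes "continuous_on S w" and "kap > 0" and "kap \<notin> \<int> \<Longrightarrow> \<forall>x\<in>S. 0 \<le> rho (w x)"
  shows "continuous_on S (\<lambda>x. source m lam kap (w x))"
proof -
  have rho: "continuous_on S (\<lambda>x. rho (w x))"
    unfolding rho_def by (intro continuous_intros assms)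
  have "continuous_on S (\<lambda>x. real_pow (rho (w x)) kap)"
  proof (cases "kap \<in> \<int>")
    case True
    then show ?thesis unfolding real_pow_def using rho by (simp add: continuous_on_power)
  next
    case False
    then show ?thesis unfolding real_pow_def using rho assms
      by (auto intro!: continuous_on_powr')
  qed
  moreover have "continuous_on S (\<lambda>x. gamma *v w x)"
    by (intro continuous_intros assms)
  ultimately show ?thesis
    unfolding source_def gfun_def by (intro continuous_intros assms)
qed

section \<open>The charge balance\<close>

text \<open>By symmetry of \<open>alpha\<close> and \<open>beta\<close> the integrand on the left is \<open>\<partial>\<^sub>1 f1 + \<partial>\<^sub>2 f2\<close> with the quadratic
  forms \<open>f1 = (P \<bullet> alpha P) / 2\<close> and \<open>f2 = (P \<bullet> beta P) / 2\<close>, and the integrand on the edges is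
  \<open>n\<^sub>1 f1 + n\<^sub>2 f2\<close>.\<close>

lemma volume_flux_eq_edge_flux:
  assumes K: "element K" and P: "\<And>l. has_cont_grad (\<lambda>x. P x $ l) (g l)"
  shows "integral K (\<lambda>x. \<Sum>l\<in>UNIV. flux (P x) $ l \<bullet> g l x)
    = (\<Sum>e | e edge_of K. edge_integral e (\<lambda>x. (flux (P x) *v outward_normal K e) \<bullet> P x / 2))"
proof -
  note body = element_convex_body[OF K]
  obtain E where E: "oriented_boundary K E" and div: "\<And>d. divergence_formula K E d"
    using element_boundary[OF K] by blast
  \<comment> \<open>The factor \<open>- 1\<close> makes \<open>f2\<close> an instance of the rules for sums and multiples.\<close>
  define f1 f2 where "f1 = (\<lambda>x. P x $ 1 * P x $ 2 + P x $ 3 * P x $ 4)"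
    and "f2 = (\<lambda>x. P x $ 1 * P x $ 4 + (- 1) * (P x $ 2 * P x $ 3))"
  define g1 g2 where "g1 = (\<lambda>x. P x $ 1 *\<^sub>R g 2 x + P x $ 2 *\<^sub>R g 1 x + (P x $ 3 *\<^sub>R g 4 x + P x $ 4 *\<^sub>R g 3 x))"
    and "g2 = (\<lambda>x. P x $ 1 *\<^sub>R g 4 x + P x $ 4 *\<^sub>R g 1 x + (- 1) *\<^sub>R (P x $ 2 *\<^sub>R g 3 x + P x $ 3 *\<^sub>R g 2 x))"
  have fg: "has_cont_grad f1 g1" "has_cont_grad f2 g2"
    unfolding f1_def g1_def f2_def g2_def
    by (intro has_cont_grad_add has_cont_grad_cmult has_cont_grad_mult P)+
  have cont: "continuous_on S f1" "continuous_on S f2" for S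
    using fg by (auto intro: has_cont_grad_continuous_on)
  have contg: "continuous_on K g1" "continuous_on K g2"
    using fg by (auto simp: has_cont_grad_def intro: continuous_on_subset)
  have "(\<Sum>l\<in>UNIV. flux (P x) $ l \<bullet> g l x) = g1 x \<bullet> axis 1 1 + g2 x \<bullet> axis 2 1" for x
    by (simp add: sum_4 flux_nth inner_axis g1_def g2_def)
       (simp add: inner_vec_def sum_2 algebra_simps)
  then have "integral K (\<lambda>x. \<Sum>l\<in>UNIV. flux (P x) $ l \<bullet> g l x)
      = integral K (\<lambda>x. g1 x \<bullet> axis 1 1) + integral K (\<lambda>x. g2 x \<bullet> axis 2 1)"
    by (simp add: integral_add integrable_continuous_compact body(1) continuous_intros contg)
  also have "\<dots> = (\<Sum>(p, q)\<in>E. cross2 (axis 1 1) (q - p) * segment_mean f1 p q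
      + cross2 (axis 2 1) (q - p) * segment_mean f2 p q)"
    using div fg by (simp add: divergence_formula_def case_prod_unfold sum.distrib)
  also have "\<dots> = (\<Sum>(p, q)\<in>E. edge_integral (closed_segment p q)
      (\<lambda>x. (flux (P x) *v outward_normal K (closed_segment p q)) \<bullet> P x / 2))"
  proof (intro sum.cong refl, clarify)
    fix p q assume pq: "(p, q) \<in> E"
    let ?e = "closed_segment p q"
    define n where "n = outward_normal K ?e"
    have n: "norm (q - p) * n $ 1 = cross2 (axis 1 1) (q - p)" "norm (q - p) * n $ 2 = cross2 (axis 2 1) (q - p)"
      using oriented_edge_normal(2)[OF E pq body(3), of "axis 1 1"]
        oriented_edge_normal(2)[OF E pq body(3), of "axis 2 1"] by (simp_all add: n_def inner_axis)
    have "edge_integral ?e (\<lambda>x. (flux (P x) *v n) \<bullet> P x / 2) = edge_integral ?e (\<lambda>x. n $ 1 * f1 x + n $ 2 * f2 x)"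
      by (rule arg_cong[where f = "edge_integral ?e"]) (simp add: fun_eq_iff flux_inner f1_def f2_def field_simps)
    also have "\<dots> = n $ 1 * edge_integral ?e f1 + n $ 2 * edge_integral ?e f2"
      by (simp add: edge_integral_add[OF refl] edge_integral_cmult[OF refl] continuous_intros cont)
    also have "\<dots> = (norm (q - p) * n $ 1) * segment_mean f1 p q + (norm (q - p) * n $ 2) * segment_mean f2 p q"
      by (simp add: edge_integral_eq_segment_mean cont)
    finally show "cross2 (axis 1 1) (q - p) * segment_mean f1 p q + cross2 (axis 2 1) (q - p) * segment_mean f2 p q
      = edge_integral ?e (\<lambda>x. (flux (P x) *v outward_normal K ?e) \<bullet> P x / 2)"
      by (simp only: n flip: n_def)
  qed
  also have "\<dots> = (\<Sum>e | e edge_of K. edge_integral e (\<lambda>x. (flux (P x) *v outward_normal K e) \<bullet> P x / 2))"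
    using E by (auto simp: oriented_boundary_def case_prod_unfold intro!: sum.reindex_bij_betw[of "\<lambda>(p, q). closed_segment p q", simplified case_prod_unfold])
  finally show ?thesis .
qed

definition neighbour :: "(real^2) set set \<Rightarrow> (real^2) set \<Rightarrow> (real^2) set \<Rightarrow> (real^2) set" where
  "neighbour T K e = (THE K'. neighbour_at T K e K')"

text \<open>The exterior trace under the homogeneous boundary condition, in terms of the polynomials \<open>P K\<close> that
  represent the solution inside the elements.\<close>

definition exterior_value ::
  "(real^2) set \<Rightarrow> (real^2) set set \<Rightarrow> ((real^2) set \<Rightarrow> real^2 \<Rightarrow> real^4) \<Rightarrow> (real^2) set \<Rightarrow> (real^2) set \<Rightarrow> real^2 \<Rightarrow> real^4"
  where "exterior_value \<Omega> T P K e x = (if e \<subseteq> frontier \<Omega> then 0 else P (neighbour T K e) x)"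

text \<open>What remains of the Lax--Friedrichs flux, tested with the interior trace, after half of the interior
  flux has been cancelled by the volume term (see \<open>edge_dissipation_alt\<close>).\<close>

definition edge_dissipation :: "real^2 \<Rightarrow> real^4 \<Rightarrow> real^4 \<Rightarrow> real" where
  "edge_dissipation n wm wp = ((flux wp *v n) \<bullet> wm - wp \<bullet> wm + wm \<bullet> wm) / 2"

lemma edge_dissipation_alt:
  "edge_dissipation n wm wp = lax_friedrichs n wm wp \<bullet> wm - (flux wm *v n) \<bullet> wm / 2"
  by (simp add: edge_dissipation_def lax_friedrichs_inner field_simps)

lemma edge_dissipation_zero: "0 \<le> edge_dissipation n wm 0"
  by (simp add: edge_dissipation_def flux_inner)

text \<open>Adding the contributions of the two elements at an edge cancels the flux terms, because the flux is
  symmetric and odd in the normal, and completes the square of the jump.\<close>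

lemma edge_dissipation_symmetric:
  "0 \<le> edge_dissipation n wm wp + edge_dissipation (- n) wp wm"
proof -
  have "(flux wm *v (- n)) \<bullet> wp = - ((flux wp *v n) \<bullet> wm)"
    by (simp add: flux_inner algebra_simps)
  then have "edge_dissipation n wm wp + edge_dissipation (- n) wp wm = ((wm - wp) \<bullet> (wm - wp)) / 2"
    by (simp add: edge_dissipation_def inner_diff_left inner_diff_right inner_commute field_simps)
  also have "0 \<le> \<dots>" by simp
  finally show ?thesis .
qed

lemma continuous_on_edge_dissipation:
  fixes S :: "'a::euclidean_space set"
  shows "continuous_on S w \<Longrightarrow> continuous_on S z \<Longrightarrow> continuous_on S (\<lambda>x. edge_dissipation n (w x) (z x))"
  unfolding edge_dissipation_def flux_mult by (intro continuous_intros) auto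

lemma flux_nth_inner: "flux w $ l \<bullet> z = (alpha *v w) $ l * z $ 1 + (beta *v w) $ l * z $ 2"
  by (simp add: flux_def inner_vec_def sum_2)

lemma conforming_meshD:
  assumes "conforming_mesh \<Omega> T"
  shows "finite T" "\<And>K. K \<in> T \<Longrightarrow> element K" "\<Union>T = closure \<Omega>" "\<And>K. K \<in> T \<Longrightarrow> interior K \<subseteq> \<Omega>"
    "\<And>K K'. K \<in> T \<Longrightarrow> K' \<in> T \<Longrightarrow> K \<noteq> K' \<Longrightarrow> interior K \<inter> interior K' = {}"
    "\<And>K e. K \<in> T \<Longrightarrow> e edge_of K \<Longrightarrow> e \<subseteq> frontier \<Omega> \<or> (\<exists>!K'. neighbour_at T K e K')"
  using assms unfolding conforming_mesh_def by simp_all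

text \<open>Across an interior edge the relation of being neighbours is symmetric, and uniqueness of the
  neighbour makes passing to the other side an involution.\<close>

lemma neighbour_symmetric:
  assumes mesh: "conforming_mesh \<Omega> T" and K: "K \<in> T" and e: "e edge_of K" "\<not> e \<subseteq> frontier \<Omega>"
  shows "neighbour T K e \<in> T" "neighbour T K e \<noteq> K" "e edge_of neighbour T K e"
    "e \<subseteq> neighbour T K e" "neighbour T (neighbour T K e) e = K"
proof -
  have "\<exists>!K'. neighbour_at T K e K'"
    using conforming_meshD(6)[OF mesh K e(1)] e(2) by blast
  then have "neighbour_at T K e (neighbour T K e)"
    unfolding neighbour_def by (rule theI')
  then have n: "neighbour T K e \<in> T" "neighbour T K e \<noteq> K" "e edge_of neighbour T K e"
    "e = K \<inter> neighbour T K e"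
    by (auto simp: neighbour_at_def)
  then show "neighbour T K e \<in> T" "neighbour T K e \<noteq> K" "e edge_of neighbour T K e"
    "e \<subseteq> neighbour T K e" by auto
  have "\<exists>!K'. neighbour_at T (neighbour T K e) e K'"
    using conforming_meshD(6)[OF mesh n(1) n(3)] e(2) by blast
  moreover have "neighbour_at T (neighbour T K e) e K"
    using n K e(1) by (auto simp: neighbour_at_def)
  ultimately show "neighbour T (neighbour T K e) e = K"
    unfolding neighbour_def[of T "neighbour T K e"] by (rule the1_equality)
qed

lemma edge_of_element:
  assumes "element K" "e edge_of K"
  obtains p q where "e = closed_segment p q" "p \<noteq> q" "is_outward_normal K e (outward_normal K e)"
proof -
  obtain E where E: "oriented_boundary K E"
    using element_boundary[OF assms(1)] by blast
  then have "e \<in> (\<lambda>(p, q). closed_segment p q) ` E"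
    using assms(2) by (auto simp: oriented_boundary_def bij_betw_def)
  then obtain p q where pq: "(p, q) \<in> E" "e = closed_segment p q" by auto
  moreover have "p \<noteq> q" using E pq by (auto simp: oriented_boundary_def)
  ultimately show thesis
    using that oriented_edge_normal(1)[OF E pq(1) element_convex_body(3)[OF assms(1)]] by simp
qed

lemma finite_edges_of_element:
  assumes "element K"
  shows "finite {e. e edge_of K}"
proof -
  obtain E where "oriented_boundary K E"
    using element_boundary[OF assms] by blast
  then show ?thesis
    unfolding oriented_boundary_def by (auto simp: bij_betw_finite)
qed

lemma neighbour_outward_normal:
  assumes mesh: "conforming_mesh \<Omega> T" and K: "K \<in> T" and e: "e edge_of K" "\<not> e \<subseteq> frontier \<Omega>"
  shows "outward_normal (neighbour T K e) e = - outward_normal K e"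
proof -
  let ?K = "neighbour T K e"
  note nb = neighbour_symmetric[OF mesh K e]
  have el: "element K" "element ?K" using conforming_meshD(2)[OF mesh] K nb(1) by auto
  obtain p q where pq: "e = closed_segment p q" "p \<noteq> q" and n: "is_outward_normal K e (outward_normal K e)"
    using edge_of_element[OF el(1) e(1)] .
  have n': "is_outward_normal ?K e (outward_normal ?K e)"
    using edge_of_element[OF el(2) nb(3)] by blast
  show ?thesis
    using opposite_outward_normals[of K ?K p q "outward_normal K e" "outward_normal ?K e"]
      element_convex_body[OF el(1)] element_convex_body[OF el(2)] conforming_meshD(5)[OF mesh K nb(1)]
      nb edge_of_imp_subset[OF e(1)] n n' pq by auto
qed

text \<open>On the pairs of an element and an interior edge, passing to the other element is an involution
  \<open>\<sigma>\<close>. Hence twice the sum over these pairs is the sum of the contributions of \<open>z\<close> and \<open>\<sigma> z\<close>, and each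
  of these is nonnegative by \<open>edge_dissipation_symmetric\<close>.\<close>

lemma total_edge_dissipation_nonneg:
  assumes mesh: "conforming_mesh \<Omega> T" and P: "\<And>K. K \<in> T \<Longrightarrow> continuous_on UNIV (P K)"
  shows "0 \<le> (\<Sum>K\<in>T. \<Sum>e | e edge_of K. edge_integral e (\<lambda>x.
            edge_dissipation (outward_normal K e) (P K x) (exterior_value \<Omega> T P K e x)))"
proof -
  let ?D = "\<lambda>(K, e). edge_integral e (\<lambda>x.
            edge_dissipation (outward_normal K e) (P K x) (exterior_value \<Omega> T P K e x))"
  define Z where "Z = Sigma T (\<lambda>K. {e. e edge_of K})"
  define B where "B = {z \<in> Z. snd z \<subseteq> frontier \<Omega>}"
  define I where "I = {z \<in> Z. \<not> snd z \<subseteq> frontier \<Omega>}"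
  define \<sigma> where "\<sigma> = (\<lambda>(K, e). (neighbour T K e, e))"
  have fin: "finite Z"
    unfolding Z_def using conforming_meshD(1,2)[OF mesh] finite_edges_of_element by auto
  have "(\<Sum>K\<in>T. \<Sum>e | e edge_of K. ?D (K, e)) = sum ?D Z"
    unfolding Z_def using conforming_meshD(1,2)[OF mesh] finite_edges_of_element
    by (subst sum.Sigma) auto
  also have "sum ?D Z = sum ?D B + sum ?D I"
  proof -
    have "Z = B \<union> I" "B \<inter> I = {}" by (auto simp: B_def I_def)
    then show ?thesis using fin by (simp add: sum.union_disjoint)
  qed
  finally have eq: "(\<Sum>K\<in>T. \<Sum>e | e edge_of K. ?D (K, e)) = sum ?D B + sum ?D I" .
  have "0 \<le> sum ?D B"
  proof (rule sum_nonneg)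
    fix z assume "z \<in> B"
    then obtain K e where z: "z = (K, e)" "K \<in> T" "e edge_of K" "e \<subseteq> frontier \<Omega>"
      by (auto simp: B_def Z_def)
    obtain p q where "e = closed_segment p q"
      using edge_of_element[OF conforming_meshD(2)[OF mesh z(2)] z(3)] by blast
    then show "0 \<le> ?D z"
      using z(4) by (auto simp: z(1) exterior_value_def edge_dissipation_zero intro!: edge_integral_nonneg)
  qed
  moreover have "0 \<le> sum ?D I"
  proof -
    have \<sigma>: "\<sigma> z \<in> I" "\<sigma> (\<sigma> z) = z" if "z \<in> I" for z
    proof -
      obtain K e where z: "z = (K, e)" "K \<in> T" "e edge_of K" "\<not> e \<subseteq> frontier \<Omega>"
        using \<open>z \<in> I\<close> unfolding I_def Z_def by fastforce
      then show "\<sigma> z \<in> I" "\<sigma> (\<sigma> z) = z"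
        using neighbour_symmetric[OF mesh z(2-4)] by (simp_all add: I_def Z_def \<sigma>_def)
    qed
    have "sum ?D I = sum (\<lambda>z. ?D (\<sigma> z)) I"
      by (rule sum.reindex_bij_witness[where i = \<sigma> and j = \<sigma>]) (use \<sigma> in auto)
    then have "2 * sum ?D I = (\<Sum>z\<in>I. ?D z + ?D (\<sigma> z))"
      by (simp add: sum.distrib)
    also have "0 \<le> \<dots>"
    proof (rule sum_nonneg)
      fix z assume "z \<in> I"
      then obtain K e where z: "z = (K, e)" and K: "K \<in> T" and e: "e edge_of K" "\<not> e \<subseteq> frontier \<Omega>"
        unfolding I_def Z_def by fastforce
      note nb = neighbour_symmetric[OF mesh K e]
      obtain p q where pq: "e = closed_segment p q"
        using edge_of_element[OF conforming_meshD(2)[OF mesh K] e(1)] by blast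
      let ?n = "outward_normal K e" and ?L = "neighbour T K e"
      have c: "continuous_on e (P K)" "continuous_on e (P ?L)"
        using P K nb(1) continuous_on_subset by blast+
      have "?D z + ?D (\<sigma> z) = edge_integral e (\<lambda>x. edge_dissipation ?n (P K x) (P ?L x))
          + edge_integral e (\<lambda>x. edge_dissipation (- ?n) (P ?L x) (P K x))"
        using e(2) nb(5) neighbour_outward_normal[OF mesh K e] by (simp add: z \<sigma>_def exterior_value_def)
      also have "\<dots> = edge_integral e (\<lambda>x. edge_dissipation ?n (P K x) (P ?L x)
          + edge_dissipation (- ?n) (P ?L x) (P K x))"
        by (rule edge_integral_add[OF pq, symmetric]) (intro continuous_on_edge_dissipation c)+
      also have "0 \<le> \<dots>"
        by (rule edge_integral_nonneg[OF pq]) (rule edge_dissipation_symmetric)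
      finally show "0 \<le> ?D z + ?D (\<sigma> z)" .
    qed
    finally show ?thesis by simp
  qed
  ultimately show ?thesis using eq by simp
qed

text \<open>Here \<open>w\<close> is the solution at a fixed time and \<open>wdot\<close> its time derivative, and the scheme is tested with
  the components of \<open>w\<close> itself. Everything is rewritten in terms of the polynomials \<open>P K\<close>; the volume
  flux becomes an edge integral, the source vanishes after summation over the components, and the edge
  terms combine.\<close>

lemma element_balance:
  assumes mesh: "conforming_mesh \<Omega> T" and K: "K \<in> T" and kap: "kap > 0"
    and P: "\<And>K l. K \<in> T \<Longrightarrow> (\<lambda>x. P K x $ l) \<in> poly_space q"
    and w: "\<And>K x. K \<in> T \<Longrightarrow> x \<in> interior K \<Longrightarrow> w x = P K x"
    and rho: "kap \<notin> \<int> \<Longrightarrow> \<forall>x\<in>interior K. 0 \<le> rho (w x)"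
    and bdry: "\<forall>x\<in>frontier \<Omega>. b x = 0"
    and scheme: "\<And>l. (LINT x:K|lebesgue. wdot x $ l * w x $ l) =
        - (\<Sum>e | e edge_of K. edge_integral e (\<lambda>x.
              lax_friedrichs (outward_normal K e)
                (trace_in K w x) (trace_out \<Omega> T b K e w x) $ l
              * trace_in K (\<lambda>x. w x $ l) x))
        + (LINT x:K|lebesgue.
              flux (w x) $ l \<bullet> grad (\<lambda>x. w x $ l) x + source m lam kap (w x) $ l * w x $ l)"
  shows "(\<Sum>l\<in>UNIV. LINT x:K|lebesgue. wdot x $ l * w x $ l)
     = - (\<Sum>e | e edge_of K. edge_integral e (\<lambda>x.
            edge_dissipation (outward_normal K e) (P K x) (exterior_value \<Omega> T P K e x)))"
proof -
  have el: "element K" using conforming_meshD(2)[OF mesh K] .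
  note body = element_convex_body[OF el]
  have closed: "closed K" using body(1) by (rule compact_imp_closed)
  have Pg: "has_cont_grad (\<lambda>x. P L x $ l) (grad (\<lambda>x. P L x $ l))" if "L \<in> T" for L l
    by (rule poly_space_has_cont_grad[OF P[OF that]])
  have Pc: "continuous_on S (P L)" if "L \<in> T" for L S
    unfolding continuous_on_componentwise[where f = "P L"] Basis_vec_def
    using has_cont_grad_continuous_on[OF Pg[OF that]] by (auto simp: inner_axis)
  have tr_vec: "trace_in L w x = P L x" if "L \<in> T" "x \<in> L" for L x
  proof -
    note bodyL = element_convex_body[OF conforming_meshD(2)[OF mesh that(1)]]
    show ?thesis
      by (rule trace_in_eq[OF bodyL(2,3) compact_imp_closed[OF bodyL(1)] that(2) Pc[OF that(1)]])
         (rule w[OF that(1)])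
  qed
  have tr_comp: "trace_in K (\<lambda>x. w x $ l) x = P K x $ l" if "x \<in> K" for x l
    by (rule trace_in_eq[OF body(2,3) closed that])
       (use Pc[OF K, of UNIV] w[OF K] in \<open>auto intro!: continuous_intros\<close>)
  have edge: "edge_integral e (\<lambda>x. lax_friedrichs (outward_normal K e)
                (trace_in K w x) (trace_out \<Omega> T b K e w x) $ l * trace_in K (\<lambda>x. w x $ l) x)
      = edge_integral e (\<lambda>x. lax_friedrichs (outward_normal K e)
                (P K x) (exterior_value \<Omega> T P K e x) $ l * P K x $ l)" if e: "e edge_of K" for e l
  proof -
    obtain p q where pq: "e = closed_segment p q"
      using edge_of_element[OF el e] by blast
    show ?thesis
    proof (rule edge_integral_cong[OF pq])
      fix x assume x: "x \<in> e"
      then have xK: "x \<in> K" using edge_of_imp_subset[OF e] by blast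
      have "trace_out \<Omega> T b K e w x = exterior_value \<Omega> T P K e x"
      proof (cases "e \<subseteq> frontier \<Omega>")
        case True
        then show ?thesis using bdry x by (auto simp: trace_out_def exterior_value_def)
      next
        case False
        note nb = neighbour_symmetric[OF mesh K e False]
        have "x \<in> neighbour T K e" using nb(4) x by blast
        then show ?thesis
          using False tr_vec[OF nb(1)] by (simp add: trace_out_def exterior_value_def flip: neighbour_def)
      qed
      then show "lax_friedrichs (outward_normal K e)
                (trace_in K w x) (trace_out \<Omega> T b K e w x) $ l * trace_in K (\<lambda>x. w x $ l) x
        = lax_friedrichs (outward_normal K e) (P K x) (exterior_value \<Omega> T P K e x) $ l * P K x $ l"
        by (simp add: tr_vec[OF K xK] tr_comp[OF xK])
    qed
  qed
  have extc: "continuous_on e (exterior_value \<Omega> T P K e)" if "e edge_of K" for e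
  proof (cases "e \<subseteq> frontier \<Omega>")
    case True
    then have "exterior_value \<Omega> T P K e = (\<lambda>x. 0)" by (simp add: exterior_value_def fun_eq_iff)
    then show ?thesis by simp
  next
    case False
    then have "exterior_value \<Omega> T P K e = P (neighbour T K e)" by (simp add: exterior_value_def fun_eq_iff)
    then show ?thesis using Pc neighbour_symmetric(1)[OF mesh K that False] by simp
  qed
  \<comment> \<open>The sign condition on \<open>rho\<close> extends from the interior to the whole element by continuity; it is needed
    on a compact set, where continuity of the source gives integrability.\<close>
  have rhoP: "\<forall>x\<in>K. 0 \<le> rho (P K x)" if "kap \<notin> \<int>"
  proof
    fix x assume "x \<in> K"
    then have x: "x \<in> closure (interior K)"
      using body closed by (simp add: convex_closure_interior closure_closed)
    have "continuous_on (closure (interior K)) (\<lambda>x. rho (P K x))"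
      unfolding rho_def by (intro continuous_intros Pc[OF K])
    then show "0 \<le> rho (P K x)"
      by (rule continuous_ge_on_closure[OF _ x]) (use rho[OF that] w[OF K] in auto)
  qed
  define h where "h l x = flux (P K x) $ l \<bullet> grad (\<lambda>x. P K x $ l) x + source m lam kap (P K x) $ l * P K x $ l" for l x
  have "continuous_on K (h l)" for l
  proof -
    have "continuous_on K (\<lambda>x. source m lam kap (P K x))"
      by (rule continuous_on_source[OF Pc[OF K] kap rhoP])
    moreover have "continuous_on K (grad (\<lambda>x. P K x $ l))"
      using Pg[OF K] by (auto simp: has_cont_grad_def intro: continuous_on_subset)
    ultimately show ?thesis
      unfolding h_def flux_nth_inner by (intro continuous_intros Pc[OF K])
  qed
  note hc = this
  have vol: "(LINT x:K|lebesgue. flux (w x) $ l \<bullet> grad (\<lambda>x. w x $ l) x + source m lam kap (w x) $ l * w x $ l)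
      = integral K (h l)" for l
  proof (rule set_integral_interior_cong[OF body(1,2) hc])
    fix x assume x: "x \<in> interior K"
    have "frechet_derivative (\<lambda>x. w x $ l) (at x) = (\<lambda>v. grad (\<lambda>x. P K x $ l) x \<bullet> v)"
    proof (rule frechet_derivative_at[symmetric])
      have "((\<lambda>x. P K x $ l) has_derivative (\<lambda>v. grad (\<lambda>x. P K x $ l) x \<bullet> v)) (at x)"
        using Pg[OF K] by (simp add: has_cont_grad_def)
      then show "((\<lambda>x. w x $ l) has_derivative (\<lambda>v. grad (\<lambda>x. P K x $ l) x \<bullet> v)) (at x)"
        by (rule has_derivative_transform_within_open[OF _ open_interior x]) (simp add: w[OF K])
    qed
    then have "grad (\<lambda>x. w x $ l) x = grad (\<lambda>x. P K x $ l) x"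
      unfolding grad_def[of "\<lambda>x. w x $ l"] by (simp add: vec_eq_iff inner_axis)
    then show "flux (w x) $ l \<bullet> grad (\<lambda>x. w x $ l) x + source m lam kap (w x) $ l * w x $ l = h l x"
      by (simp add: h_def w[OF K x])
  qed
  have "(\<Sum>l\<in>UNIV. integral K (h l)) = integral K (\<lambda>x. \<Sum>l\<in>UNIV. h l x)"
    by (simp add: integral_sum integrable_continuous_compact body(1) hc)
  also have "(\<lambda>x. \<Sum>l\<in>UNIV. h l x) = (\<lambda>x. \<Sum>l\<in>UNIV. flux (P K x) $ l \<bullet> grad (\<lambda>x. P K x $ l) x)"
  proof
    fix x
    have "(\<Sum>l\<in>UNIV. source m lam kap (P K x) $ l * P K x $ l) = 0"
      using source_inner_self[of m lam kap "P K x"] by (simp add: inner_vec_def)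
    then show "(\<Sum>l\<in>UNIV. h l x) = (\<Sum>l\<in>UNIV. flux (P K x) $ l \<bullet> grad (\<lambda>x. P K x $ l) x)"
      by (simp add: h_def sum.distrib)
  qed
  also have "integral K \<dots> = (\<Sum>e | e edge_of K. edge_integral e (\<lambda>x. (flux (P K x) *v outward_normal K e) \<bullet> P K x / 2))"
    by (rule volume_flux_eq_edge_flux[OF el Pg[OF K]])
  finally have volsum: "(\<Sum>l\<in>UNIV. integral K (h l)) = \<dots>" .
  have "(\<Sum>l\<in>UNIV. LINT x:K|lebesgue. wdot x $ l * w x $ l)
      = - (\<Sum>e | e edge_of K. \<Sum>l\<in>UNIV. edge_integral e (\<lambda>x. lax_friedrichs (outward_normal K e)
                (P K x) (exterior_value \<Omega> T P K e x) $ l * P K x $ l))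
        + (\<Sum>e | e edge_of K. edge_integral e (\<lambda>x. (flux (P K x) *v outward_normal K e) \<bullet> P K x / 2))"
    by (simp add: scheme vol edge volsum[symmetric] sum.distrib sum_negf sum_subtractf sum.swap[of _ "UNIV :: 4 set"])
  also have "\<dots> = - (\<Sum>e | e edge_of K. (\<Sum>l\<in>UNIV. edge_integral e (\<lambda>x. lax_friedrichs (outward_normal K e)
                (P K x) (exterior_value \<Omega> T P K e x) $ l * P K x $ l))
        - edge_integral e (\<lambda>x. (flux (P K x) *v outward_normal K e) \<bullet> P K x / 2))"
    by (simp add: sum_subtractf)
  also have "\<dots> = - (\<Sum>e | e edge_of K. edge_integral e (\<lambda>x.
            edge_dissipation (outward_normal K e) (P K x) (exterior_value \<Omega> T P K e x)))"
  proof (intro arg_cong[where f = uminus] sum.cong refl)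
    fix e assume "e \<in> {e. e edge_of K}"
    then have e: "e edge_of K" by simp
    obtain p q where pq: "e = closed_segment p q"
      using edge_of_element[OF el e] by blast
    let ?n = "outward_normal K e" and ?W = "exterior_value \<Omega> T P K e"
    have lf: "continuous_on e (\<lambda>x. lax_friedrichs ?n (P K x) (?W x) $ l * P K x $ l)" for l
      by (intro continuous_intros continuous_on_lax_friedrichs Pc[OF K] extc[OF e])
    have fl: "continuous_on e (\<lambda>x. (flux (P K x) *v ?n) \<bullet> P K x / 2)"
      unfolding flux_mult by (intro continuous_intros Pc[OF K]) simp
    have "(\<Sum>l\<in>UNIV. edge_integral e (\<lambda>x. lax_friedrichs ?n (P K x) (?W x) $ l * P K x $ l))
      = edge_integral e (\<lambda>x. lax_friedrichs ?n (P K x) (?W x) \<bullet> P K x)"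
      unfolding inner_vec_def inner_real_def
      by (rule edge_integral_sum[OF pq, symmetric]) (simp_all add: lf)
    also have "\<dots> = edge_integral e (\<lambda>x. edge_dissipation ?n (P K x) (?W x) + (flux (P K x) *v ?n) \<bullet> P K x / 2)"
      by (simp add: edge_dissipation_alt)
    also have "\<dots> = edge_integral e (\<lambda>x. edge_dissipation ?n (P K x) (?W x))
        + edge_integral e (\<lambda>x. (flux (P K x) *v ?n) \<bullet> P K x / 2)"
      by (intro edge_integral_add[OF pq] fl continuous_on_edge_dissipation Pc[OF K] extc[OF e])
    finally show "(\<Sum>l\<in>UNIV. edge_integral e (\<lambda>x. lax_friedrichs ?n (P K x) (?W x) $ l * P K x $ l))
        - edge_integral e (\<lambda>x. (flux (P K x) *v ?n) \<bullet> P K x / 2)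
      = edge_integral e (\<lambda>x. edge_dissipation ?n (P K x) (?W x))" by simp
  qed
  finally show ?thesis .
qed

text \<open>Outside the boundaries of the elements, which form a negligible set, a point of the domain lies in
  exactly one element.\<close>

lemma charge_eq_sum:
  assumes mesh: "conforming_mesh \<Omega> T"
    and P: "\<And>K. K \<in> T \<Longrightarrow> continuous_on UNIV (P K)"
    and u: "\<And>K x. K \<in> T \<Longrightarrow> x \<in> interior K \<Longrightarrow> u t x = P K x"
  shows "charge \<Omega> u t = ennreal (\<Sum>K\<in>T. \<Sum>l\<in>UNIV. LINT x:K|lebesgue. (u t x $ l)\<^sup>2)"
proof -
  define h where "h K x = (\<Sum>l\<in>UNIV. (P K x $ l)\<^sup>2)" for K x
  have hc: "continuous_on S (h K)" if "K \<in> T" for K S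
    unfolding h_def using P[OF that] by (auto intro!: continuous_intros intro: continuous_on_subset)
  have hpos: "0 \<le> h K x" for K x by (simp add: h_def sum_nonneg)
  define N where "N = (\<Union>K\<in>T. frontier K)"
  have "negligible N"
    unfolding N_def using conforming_meshD(1,2)[OF mesh] element_convex_body(2)
    by (intro negligible_Union) (auto intro: negligible_convex_frontier)
  then have N: "N \<in> null_sets lebesgue" by (simp add: negligible_iff_null_sets)
  have split: "ennreal (\<Sum>l\<in>UNIV. \<bar>u t x $ l\<bar>\<^sup>2) * indicator \<Omega> x
      = (\<Sum>K\<in>T. ennreal (indicator K x *\<^sub>R h K x))" if x: "x \<notin> N" for x
  proof -
    have int: "x \<in> interior K" if "K \<in> T" "x \<in> K" for K
      using x that closure_subset by (auto simp: N_def frontier_def)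
    show ?thesis
    proof (cases "x \<in> \<Omega>")
      case True
      then have "x \<in> \<Union>T" using conforming_meshD(3)[OF mesh] closure_subset by blast
      then obtain K where K: "K \<in> T" "x \<in> K" by blast
      have "(\<Sum>L\<in>T. ennreal (indicator L x *\<^sub>R h L x)) = (\<Sum>L\<in>T. if L = K then ennreal (h K x) else 0)"
      proof (rule sum.cong[OF refl])
        fix L assume L: "L \<in> T"
        show "ennreal (indicator L x *\<^sub>R h L x) = (if L = K then ennreal (h K x) else 0)"
        proof (cases "L = K")
          case False
          then have "x \<notin> L"
            using int[OF L] int[OF K] conforming_meshD(5)[OF mesh L K(1) False] by blast
          then show ?thesis using False by simp
        qed (use K in simp)
      qed
      also have "\<dots> = ennreal (h K x)" using K conforming_meshD(1)[OF mesh] by simp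
      finally show ?thesis using True u[OF K(1) int[OF K]] by (simp add: h_def)
    next
      case False
      then have "x \<notin> K" if "K \<in> T" for K
        using int[OF that] conforming_meshD(4)[OF mesh that] by blast
      then show ?thesis using False by (simp add: sum.neutral)
    qed
  qed
  have int: "integrable lborel (\<lambda>x. indicator K x *\<^sub>R h K x)" if "K \<in> T" for K
    by (rule borel_integrable_compact[OF element_convex_body(1)[OF conforming_meshD(2)[OF mesh that]] hc[OF that]])
  have "charge \<Omega> u t = (\<integral>\<^sup>+x. (\<Sum>K\<in>T. ennreal (indicator K x *\<^sub>R h K x)) \<partial>lebesgue)"
    unfolding charge_def
    by (rule nn_integral_cong_AE) (rule AE_I'[OF N], use split in blast)
  also have "\<dots> = (\<Sum>K\<in>T. \<integral>\<^sup>+x. ennreal (indicator K x *\<^sub>R h K x) \<partial>lborel)"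
    unfolding nn_integral_completion
    by (rule nn_integral_sum) (use int in \<open>auto intro!: measurable_compose[OF _ measurable_ennreal]\<close>)
  also have "\<dots> = (\<Sum>K\<in>T. ennreal (integral K (h K)))"
  proof (rule sum.cong[OF refl])
    fix K assume K: "K \<in> T"
    have "(\<integral>\<^sup>+x. ennreal (indicator K x *\<^sub>R h K x) \<partial>lborel) = ennreal (LINT x:K|lborel. h K x)"
      unfolding set_lebesgue_integral_def
      by (rule nn_integral_eq_integral[OF int[OF K]]) (simp add: hpos)
    also have "(LINT x:K|lborel. h K x) = integral K (h K)"
      using int[OF K] by (intro set_borel_integral_eq_integral(2)) (simp add: set_integrable_def)
    finally show "(\<integral>\<^sup>+x. ennreal (indicator K x *\<^sub>R h K x) \<partial>lborel) = ennreal (integral K (h K))" .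
  qed
  also have "\<dots> = (\<Sum>K\<in>T. ennreal (\<Sum>l\<in>UNIV. LINT x:K|lebesgue. (u t x $ l)\<^sup>2))"
  proof (intro sum.cong refl arg_cong[where f = ennreal])
    fix K assume K: "K \<in> T"
    note body = element_convex_body[OF conforming_meshD(2)[OF mesh K]]
    have c: "continuous_on K (\<lambda>x. (P K x $ l)\<^sup>2)" for l
      using P[OF K] by (auto intro!: continuous_intros intro: continuous_on_subset)
    have "integral K (h K) = (\<Sum>l\<in>UNIV. integral K (\<lambda>x. (P K x $ l)\<^sup>2))"
      unfolding h_def by (rule integral_sum) (auto intro: integrable_continuous_compact body(1) c)
    also have "\<dots> = (\<Sum>l\<in>UNIV. LINT x:K|lebesgue. (u t x $ l)\<^sup>2)"
      by (intro sum.cong refl set_integral_interior_cong[OF body(1,2) c, symmetric]) (simp add: u[OF K])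
    finally show "integral K (h K) = (\<Sum>l\<in>UNIV. LINT x:K|lebesgue. (u t x $ l)\<^sup>2)" .
  qed
  also have "\<dots> = ennreal (\<Sum>K\<in>T. \<Sum>l\<in>UNIV. LINT x:K|lebesgue. (u t x $ l)\<^sup>2)"
    by (rule sum_ennreal)
       (auto intro!: sum_nonneg Bochner_Integration.integral_nonneg simp: set_lebesgue_integral_def)
  finally show ?thesis .
qed

section \<open>Decay of the charge\<close>

lemma nonincreasing_on_nonneg_reals:
  fixes f :: "real \<Rightarrow> real"
  assumes der: "\<And>t. t \<ge> 0 \<Longrightarrow> \<exists>D\<le>0. (f has_real_derivative D) (at t within {0..})" and t: "t \<ge> 0"
  shows "f t \<le> f 0"
proof -
  obtain D where D: "\<And>s. s \<ge> 0 \<Longrightarrow> D s \<le> 0 \<and> (f has_real_derivative D s) (at s within {0..})"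
    using der by metis
  show ?thesis
  proof (cases "t = 0")
    case False
    \<comment> \<open>The derivative is one-sided at \<open>0\<close>, which is all that the mean value theorem on \<open>[0, t]\<close> needs.\<close>
    have "\<exists>s\<in>{0<..<t}. f t - f 0 = (\<lambda>h. D s * h) (t - 0)"
    proof (rule mvt_simple)
      show "0 < t" using t False by simp
      fix s assume "0 \<le> s" "s \<le> t"
      then have "(f has_real_derivative D s) (at s within {0..t})"
        using D[of s] by (auto intro: has_field_derivative_subset)
      then show "(f has_derivative (\<lambda>h. D s * h)) (at s within {0..t})"
        by (simp add: has_field_derivative_def)
    qed
    then obtain s where "0 < s" "f t - f 0 = D s * t" by auto
    moreover have "D s * t \<le> 0" using D[of s] \<open>0 < s\<close> t by (simp add: mult_nonpos_nonneg)
    ultimately show ?thesis by simp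
  qed simp
qed

theorem proposition3p1:
  fixes \<Omega> :: "(real^2) set" and T :: "(real^2) set set" and q :: nat
    and m lam kap :: real
    and bdry u :: "real \<Rightarrow> real^2 \<Rightarrow> real^4"
  assumes "polygonal_domain \<Omega>" and "bounded \<Omega>"
    and "conforming_mesh \<Omega> T"
    and "m \<ge> 0" and "lam \<ge> 0" and "kap > 0"
    and "dg_solution \<Omega> T q m lam kap bdry u"
    and "\<forall>t\<ge>0. \<forall>x\<in>frontier \<Omega>. bdry t x = 0"
    and "charge \<Omega> u 0 < \<infinity>"
  shows "(\<forall>t\<ge>0. \<exists>D\<le>0.
            ((\<lambda>s. enn2real (charge \<Omega> u s)) has_real_derivative D) (at t within {0..}))
       \<and> (\<forall>t\<ge>0. charge \<Omega> u t \<le> charge \<Omega> u 0)"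
proof -
  note mesh = \<open>conforming_mesh \<Omega> T\<close>
  have space: "(\<lambda>x. u t x $ l) \<in> dg_space \<Omega> T q" if "t \<ge> 0" for t l
    using assms(7) that by (simp add: dg_solution_def)
  have diff: "(\<lambda>s. u s x) differentiable (at t within {0..})" if "t \<ge> 0" "K \<in> T" "x \<in> interior K" for t K x
    using assms(7) that by (auto simp: dg_solution_def)
  have rho: "\<forall>x\<in>interior K. 0 \<le> rho (u t x)" if "kap \<notin> \<int>" "t \<ge> 0" "K \<in> T" for t K
    using assms(7) that by (auto simp: dg_solution_def)
  have scheme: "dg_scheme \<Omega> T q m lam kap bdry u"
    using assms(7) by (simp add: dg_solution_def)
  have "\<exists>p\<in>poly_space q. \<forall>x\<in>interior K. u t x $ l = p x" if "t \<ge> 0" "K \<in> T" for t K l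
    using space[OF that(1)] that(2) unfolding dg_space_def by blast
  then obtain p where p: "\<And>t K l. t \<ge> 0 \<Longrightarrow> K \<in> T \<Longrightarrow> p t K l \<in> poly_space q"
    "\<And>t K l x. t \<ge> 0 \<Longrightarrow> K \<in> T \<Longrightarrow> x \<in> interior K \<Longrightarrow> u t x $ l = p t K l x"
    by metis
  define P where "P t K x = (\<chi> l. p t K l x)" for t K x
  have Pl: "(\<lambda>x. P t K x $ l) = p t K l" for t K l by (simp add: P_def)
  have uP: "u t x = P t K x" if "t \<ge> 0" "K \<in> T" "x \<in> interior K" for t K x
    using p(2)[OF that] by (simp add: vec_eq_iff P_def)
  have Pc: "continuous_on UNIV (P t K)" if "t \<ge> 0" "K \<in> T" for t K
    unfolding continuous_on_componentwise[where f = "P t K"] Basis_vec_def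
    using has_cont_grad_continuous_on[OF poly_space_has_cont_grad[OF p(1)[OF that]]]
    by (auto simp: inner_axis P_def)
  define Q where "Q t = (\<Sum>K\<in>T. \<Sum>l\<in>UNIV. LINT x:K|lebesgue. (u t x $ l)\<^sup>2)" for t
  have Q: "charge \<Omega> u t = ennreal (Q t)" if "t \<ge> 0" for t
    unfolding Q_def by (rule charge_eq_sum[OF mesh, of "P t"]) (use Pc uP that in auto)
  have Qpos: "0 \<le> Q t" for t
    unfolding Q_def
    by (auto intro!: sum_nonneg Bochner_Integration.integral_nonneg simp: set_lebesgue_integral_def)
  have der: "\<exists>D\<le>0. (Q has_real_derivative D) (at t within {0..})" if t: "t \<ge> 0" for t
  proof -
    let ?D = "\<Sum>K\<in>T. \<Sum>l\<in>UNIV. 2 * (LINT x:K|lebesgue. time_deriv u t x $ l * u t x $ l)"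
    have "(Q has_real_derivative ?D) (at t within {0..})"
      unfolding Q_def
    proof (intro DERIV_sum square_integral_has_derivative[where q = q] t)
      fix K l s assume K: "K \<in> T"
      show "element K" by (rule conforming_meshD(2)[OF mesh K])
      fix s :: real assume s: "0 \<le> s"
      show "\<exists>p\<in>poly_space q. \<forall>x\<in>interior K. u s x $ l = p x"
        using p[OF s K] by blast
      fix x assume x: "x \<in> interior K"
      have "((\<lambda>s. u s x) has_vector_derivative time_deriv u s x) (at s within {0..})"
        using diff[OF s K x] by (simp add: time_deriv_def vector_derivative_works)
      then show "((\<lambda>s. u s x $ l) has_real_derivative time_deriv u s x $ l) (at s within {0..})"
        unfolding has_real_derivative_iff_has_vector_derivative
        by (rule bounded_linear.has_vector_derivative[OF bounded_linear_vec_nth])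
    qed
    moreover have "?D = - 2 * (\<Sum>K\<in>T. \<Sum>e | e edge_of K. edge_integral e (\<lambda>x.
            edge_dissipation (outward_normal K e) (P t K x) (exterior_value \<Omega> T (P t) K e x)))"
    proof -
      have "?D = 2 * (\<Sum>K\<in>T. \<Sum>l\<in>UNIV. LINT x:K|lebesgue. time_deriv u t x $ l * u t x $ l)"
        by (simp only: sum_distrib_left)
      also have "(\<Sum>K\<in>T. \<Sum>l\<in>UNIV. LINT x:K|lebesgue. time_deriv u t x $ l * u t x $ l)
        = (\<Sum>K\<in>T. - (\<Sum>e | e edge_of K. edge_integral e (\<lambda>x.
            edge_dissipation (outward_normal K e) (P t K x) (exterior_value \<Omega> T (P t) K e x))))"
      proof (rule sum.cong[OF refl])
      fix K assume K: "K \<in> T"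
      show "(\<Sum>l\<in>UNIV. LINT x:K|lebesgue. time_deriv u t x $ l * u t x $ l)
        = - (\<Sum>e | e edge_of K. edge_integral e (\<lambda>x.
            edge_dissipation (outward_normal K e) (P t K x) (exterior_value \<Omega> T (P t) K e x)))"
      proof (rule element_balance[where P = "P t" and w = "u t" and wdot = "time_deriv u t" and b = "bdry t"
            and q = q and m = m and lam = lam, OF mesh K \<open>kap > 0\<close>])
        show "\<forall>x\<in>frontier \<Omega>. bdry t x = 0" using assms(8) t by blast
        show "(LINT x:K|lebesgue. time_deriv u t x $ l * u t x $ l) =
          - (\<Sum>e | e edge_of K. edge_integral e (\<lambda>x.
              lax_friedrichs (outward_normal K e)
                (trace_in K (u t) x) (trace_out \<Omega> T (bdry t) K e (u t) x) $ l
              * trace_in K (\<lambda>x. u t x $ l) x))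
          + (LINT x:K|lebesgue.
              flux (u t x) $ l \<bullet> grad (\<lambda>x. u t x $ l) x + source m lam kap (u t x) $ l * u t x $ l)" for l
          by (rule scheme[unfolded dg_scheme_def, rule_format, OF t K space[OF t]])
      qed (use p(1) t rho K in \<open>auto simp: Pl uP\<close>)
      qed
      finally show ?thesis by (simp add: sum_negf)
    qed
    moreover have "0 \<le> (\<Sum>K\<in>T. \<Sum>e | e edge_of K. edge_integral e (\<lambda>x.
            edge_dissipation (outward_normal K e) (P t K x) (exterior_value \<Omega> T (P t) K e x)))"
      by (rule total_edge_dissipation_nonneg[OF mesh]) (rule Pc[OF t])
    ultimately show ?thesis by (intro exI[of _ ?D]) auto
  qed
  show ?thesis
  proof (intro conjI allI impI)
    fix t :: real assume t: "t \<ge> 0"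
    obtain D where D: "D \<le> 0" "(Q has_real_derivative D) (at t within {0..})"
      using der[OF t] by blast
    have "((\<lambda>s. enn2real (charge \<Omega> u s)) has_real_derivative D) (at t within {0..})"
      by (rule has_field_derivative_transform_within[OF D(2) zero_less_one]) (use t Q Qpos in auto)
    then show "\<exists>D\<le>0. ((\<lambda>s. enn2real (charge \<Omega> u s)) has_real_derivative D) (at t within {0..})"
      using D(1) by blast
    show "charge \<Omega> u t \<le> charge \<Omega> u 0"
      using Q[OF t] Q[of 0] nonincreasing_on_nonneg_reals[OF der t] by (simp add: ennreal_leI)
  qed
qed

end
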